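(* Let $a',B,c,n$ be positive integers such that $a'>c$, $a'$ and $c$ are odd, $a'$ and $c$ are relatively prime, and $B$ and $n$ are relatively prime. Define the formal power series $$\phi(q)=\sum_{j=0}^\infty\phi_jq^j:=\frac{(q^{\frac{B(a'-c)}{2}},q^{\frac{B(a'+c)}{2}},q^{Ba'};q^{Ba'})_\infty}{(q^n;q^n)_\infty}.$$ Then $\phi_j\phi_{j+n}\ge 0$ for all $j\in\mathbb Z_{\ge0}$ in each of the following cases: (1) all odd prime divisors of $n$ divide $a'$; (2) $n$ is a prime number and $B$ is odd.
   Context: Notation: $(u_1,\dots,u_k;v)_\infty:=\prod_{i=0}^\infty\prod_{j=1}^k(1-u_jv^i)$. *)

theory Defs
  imports
    "HOL-Analysis.Infinite_Products"
    "HOL-Computational_Algebra.Computational_Algebra"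
begin

text \<open>
  The product is the library's \<^const>\<open>prodinf\<close>, taken with respect to the topology of formal
  power series; by lemma \<open>qpoch_has_prod\<close> it converges whenever the \<open>u\<^sub>j\<close> and \<open>v\<close> have
  zero constant term.
\<close>

definition qpoch :: "'a :: comm_ring_1 fps list \<Rightarrow> 'a fps \<Rightarrow> 'a fps" where
  "qpoch us v = (\<Prod>i. \<Prod>u\<leftarrow>us. 1 - u * v ^ i)"

text \<open>
  The coefficients of the series are integers; they are taken in \<^typ>\<open>rat\<close> because the library's
  division of power series needs a field.  For \<open>0 < n\<close> the denominator has constant term 1, so
  the division is exact.  For odd \<open>c < a\<close> the natural-number subtraction and both \<open>div 2\<close>
  are exact.
\<close>

definition phi :: "nat \<Rightarrow> nat \<Rightarrow> nat \<Rightarrow> nat \<Rightarrow> rat fps" where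
  "phi a B c n =
     qpoch [fps_X ^ (B * (a - c) div 2), fps_X ^ (B * (a + c) div 2), fps_X ^ (B * a)]
           (fps_X ^ (B * a))
     / qpoch [fps_X ^ n] (fps_X ^ n)"

lemma fps_prod_list_one_minus_nth_0:
  fixes us :: "'a :: comm_ring_1 fps list"
  assumes "\<And>u. u \<in> set us \<Longrightarrow> fps_nth u 0 = 0"
  shows "fps_nth (\<Prod>u\<leftarrow>us. 1 - u * w) 0 = 1"
  using assms by (induction us) auto

lemma fps_prod_list_one_minus_cong:
  fixes us :: "'a :: comm_ring_1 fps list" and v :: "'a fps"
  assumes "\<And>u. u \<in> set us \<Longrightarrow> fps_nth u 0 = 0" and "fps_nth v 0 = 0"
  shows "\<exists>h. (\<Prod>u\<leftarrow>us. 1 - u * v ^ i) = 1 + fps_X ^ Suc i * h"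
  using assms(1)
proof (induction us)
  case Nil
  show ?case by (intro exI[of _ 0]) simp
next
  case (Cons u us)
  obtain h where h: "(\<Prod>u\<leftarrow>us. 1 - u * v ^ i) = 1 + fps_X ^ Suc i * h"
    using Cons by auto
  have X: "\<exists>w'. w = fps_X * w'" if "fps_nth w 0 = 0" for w :: "'a fps"
    using that by (intro exI[of _ "fps_shift 1 w"]) (auto simp: fps_eq_iff)
  obtain u' v' where uv: "u = fps_X * u'" "v = fps_X * v'"
    using X[of u] X[of v] Cons.prems assms(2) by auto
  have "u * v ^ i = fps_X ^ Suc i * (u' * v' ^ i)"
    by (simp add: uv power_mult_distrib mult_ac)
  hence "(\<Prod>u\<leftarrow>u # us. 1 - u * v ^ i) =
           1 + fps_X ^ Suc i * (h - u' * v' ^ i * (1 + fps_X ^ Suc i * h))"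
    by (simp add: h algebra_simps)
  thus ?case by blast
qed

lemma qpoch_has_prod:
  fixes us :: "'a :: comm_ring_1 fps list"
  assumes "\<And>u. u \<in> set us \<Longrightarrow> fps_nth u 0 = 0" and "fps_nth v 0 = 0"
  shows "(\<lambda>i. \<Prod>u\<leftarrow>us. 1 - u * v ^ i) has_prod qpoch us v"
proof -
  define f where "f = (\<lambda>i. \<Prod>u\<leftarrow>us. 1 - u * v ^ i)"
  define P where "P = (\<lambda>n. \<Prod>i\<le>n. f i)"
  define g where "g = Abs_fps (\<lambda>k. fps_nth (P k) k)"
  have step: "fps_nth (P (Suc n)) k = fps_nth (P n) k" if "k \<le> n" for n k
  proof -
    obtain h where h: "f (Suc n) = 1 + fps_X ^ Suc (Suc n) * h"
      using fps_prod_list_one_minus_cong[OF assms] unfolding f_def by blast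
    have "P (Suc n) = P n + fps_X ^ Suc (Suc n) * (P n * h)"
      unfolding P_def by (simp add: h algebra_simps)
    thus ?thesis
      using that by (simp only: fps_add_nth fps_X_power_mult_nth) auto
  qed
  have stable: "fps_nth (P n) k = fps_nth g k" if "k \<le> n" for n k
    using that by (induction n rule: dec_induct) (auto simp: step g_def)
  have lim: "P \<longlonglongrightarrow> g"
    unfolding tendsto_fps_iff
    by (auto intro: eventually_sequentiallyI stable)
  have f_0: "fps_nth (f i) 0 = 1" for i
    unfolding f_def using assms(1) by (rule fps_prod_list_one_minus_nth_0)
  have "fps_nth g 0 = 1"
    by (simp add: g_def P_def f_0)
  hence "g \<noteq> 0" by auto
  hence prod: "f has_prod g"
    using lim by (auto simp: has_prod_def raw_has_prod_def P_def)
  have "h = g" if "f has_prod h" for h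
  proof -
    have "f i \<noteq> 0" for i
      using f_0[of i] by auto
    hence "P \<longlonglongrightarrow> h"
      using that by (auto simp: has_prod_def raw_has_prod_def P_def)
    thus ?thesis using lim LIMSEQ_unique by blast
  qed
  with prod have "(THE p. f has_prod p) = g" by blast
  with prod show ?thesis
    unfolding qpoch_def prodinf_def f_def by simp
qed

end

theory Submission
  imports Defs "HOL-Number_Theory.Cong"
begin

text \<open>
  Write \<open>E k = B k (a k - c) / 2\<close>. By the Jacobi triple product the numerator of \<open>\<phi>\<close> is
  \<open>\<Sum>\<^sub>k (-1)\<^sup>k q\<^bsup>E k\<^esup>\<close>, the sum running over all integers \<open>k\<close>, and the denominator is a series in
  \<open>q\<^sup>n\<close>. So a coefficient \<open>\<phi>\<^sub>j\<close> depends only on the \<open>k\<close> with \<open>E k \<equiv> j (mod n)\<close>: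
  \<open>\<phi>\<^sub>j = \<Sum>\<^sub>k (-1)\<^sup>k P((j - E k) / n)\<close>, where \<open>P\<close> counts partitions. The indices \<open>j\<close> and \<open>j + n\<close> see
  the same \<open>k\<close>, and the theorem follows once all \<open>\<phi>\<^sub>j\<close> with \<open>j\<close> in one residue class modulo \<open>n\<close> have
  the same sign.

  The relevant \<open>k\<close> form a few residue classes modulo \<open>2 n\<close>, and these can be grouped into pairs of
  opposite parity. Let \<open>k\<close> and \<open>k'\<close> represent such a pair and suppose that
  \<open>B (a (k + k') - c) = p' R\<close> and \<open>a B (k' - k) = p S\<close> with \<open>p p' = 2 a n B\<close>. Completing squares
  shows that the pair contributes, up to a power of \<open>q\<close> and a sign,
  \<open>(\<Sum>\<^sub>l q\<^bsup>l (p p' l + R p' - S p)\<^esup> - q\<^bsup>(p l + R) (p' l + S)\<^esup>) / (q; q)\<^sub>\<infinity>\<close>.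
  For \<open>0 < R < p\<close> and \<open>0 < S < p'\<close> this is the shape of a Virasoro minimal model character, and its
  coefficients are nonnegative (\<open>virasoro_coeff_nonneg\<close>). Other values of \<open>R\<close> and \<open>S\<close> are brought
  into this range by changing representatives and, if necessary, exchanging the two classes; the
  sign that this costs is computed in \<open>class_sum_diff_sign\<close>.

  It remains to find the pairs. If all odd primes dividing \<open>n\<close> divide \<open>a\<close>, write \<open>n = 2\<^sup>s m\<close> with
  \<open>m\<close> odd. If the congruence \<open>E k \<equiv> j (mod n)\<close> is solvable, its solutions form one class modulo \<open>m\<close>
  and two classes of opposite parity modulo \<open>2\<^bsup>s+1\<^esup>\<close>, so there is exactly one pair; it has
  \<open>p = m a B\<close> and \<open>p' = 2\<^bsup>s+1\<^esup>\<close>. If \<open>n\<close> is an odd prime that does not divide \<open>a\<close>, the congruence is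
  quadratic modulo \<open>n\<close>. A double root again gives one pair, now with \<open>p = n a B\<close> and \<open>p' = 2\<close>. Two
  distinct roots give two pairs with \<open>p = a B\<close> and \<open>p' = 2 n\<close>, whose signs agree.

  The nonnegativity of the characters is due to Andrews, Baxter, Bressoud, Burge, Forrester and
  Viennot: a finite version, built from \<open>q\<close>-binomial coefficients, obeys two recurrences with
  nonnegative coefficients inside a strip and vanishes on its walls.
\<close>

section \<open>Coefficients of q-binomials\<close>

text \<open>
  The coefficient of \<open>q\<^sup>e\<close> in the Gaussian binomial \<open>[n, k]\<^sub>q\<close>. Both \<open>k\<close> and \<open>e\<close> run
  over all integers: the recurrences for \<open>hook_sum\<close> below have factors \<open>q\<^sup>N\<close> in which \<open>N\<close> may be
  negative. With coefficients as values, multiplying by \<open>q\<^sup>d\<close> is a shift of \<open>e\<close> for every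
  integer \<open>d\<close>.
\<close>

fun qbinom_coeff :: "nat \<Rightarrow> int \<Rightarrow> int \<Rightarrow> int" where
  "qbinom_coeff 0 k e = (if k = 0 \<and> e = 0 then 1 else 0)"
| "qbinom_coeff (Suc n) k e = qbinom_coeff n (k - 1) e + qbinom_coeff n k (e - k)"

declare qbinom_coeff.simps(2) [simp del]

lemma qbinom_coeff_outside: "k < 0 \<or> int n < k \<Longrightarrow> qbinom_coeff n k e = 0"
  by (induction n arbitrary: k e) (auto simp: qbinom_coeff.simps(2))

lemma qbinom_coeff_neg: "e < 0 \<Longrightarrow> qbinom_coeff n k e = 0"
proof (induction n arbitrary: k e)
  case (Suc n)
  then show ?case
    using qbinom_coeff_outside[of k n "e - k"]
    by (cases "k < 0") (auto simp: qbinom_coeff.simps(2))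
qed auto

text \<open>
  The second \<open>q\<close>-Pascal rule. Symmetry exchanges it with the defining rule, but the symmetry of the
  coefficients is itself derived from the two rules, so that the proof here is a direct induction.
\<close>

lemma qbinom_coeff_Suc':
  "qbinom_coeff (Suc n) k e =
     qbinom_coeff n k e + qbinom_coeff n (k - 1) (e - (int n + 1 - k))"
proof (induction n arbitrary: k e)
  case 0
  show ?case by (auto simp: qbinom_coeff.simps(2))
next
  case (Suc n)
  have "qbinom_coeff (Suc (Suc n)) k e =
      qbinom_coeff (Suc n) (k - 1) e + qbinom_coeff (Suc n) k (e - k)"
    by (rule qbinom_coeff.simps(2))
  also have "qbinom_coeff (Suc n) (k - 1) e =
      qbinom_coeff n (k - 1) e + qbinom_coeff n (k - 2) (e - (int n + 2 - k))"
    by (simp add: Suc.IH algebra_simps)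
  also have "qbinom_coeff (Suc n) k (e - k) =
      qbinom_coeff n k (e - k) + qbinom_coeff n (k - 1) (e - (int n + 1))"
    by (simp add: Suc.IH algebra_simps)
  finally show ?case
    by (simp add: qbinom_coeff.simps(2)[of n] algebra_simps)
qed

lemma qbinom_coeff_symmetric: "qbinom_coeff n (int n - k) e = qbinom_coeff n k e"
proof (induction n arbitrary: k e)
  case (Suc n)
  have 1: "qbinom_coeff n (int n - k) e = qbinom_coeff n k e"
    and 2: "qbinom_coeff n (int n - (k - 1)) (e - (int (Suc n) - k)) = qbinom_coeff n (k - 1) (e - (int (Suc n) - k))"
    using Suc.IH by blast+
  show ?case
    unfolding qbinom_coeff_Suc'[of n k e] using 1 2
    by (simp add: qbinom_coeff.simps(2) algebra_simps)
qed auto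

section \<open>Nonnegativity of Virasoro characters\<close>

text \<open>
  The finite version of the character numerator, with \<open>1 / (q; q)\<^sub>\<infinity>\<close> replaced by \<open>q\<close>-binomials; up to
  notation it is the sum \<open>D\<^bsub>K,i\<^esub>(N, n - N; p - b, b)\<close> that Andrews et al. found to count partitions
  with prescribed hook differences. The truncation \<open>L\<close> leaves the recurrences intact because they
  hold term by term.
\<close>

definition hook_sum :: "int \<Rightarrow> int \<Rightarrow> int \<Rightarrow> nat \<Rightarrow> nat \<Rightarrow> int \<Rightarrow> int \<Rightarrow> int \<Rightarrow> int" where
  "hook_sum K i p L n N b e =
     (\<Sum>m = -int L..int L. qbinom_coeff n (N - K * m) (e - m * (p * (K * m + i) - K * b))
         - qbinom_coeff n (N - K * m + i) (e - (m * p - b) * (K * m - i)))"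

lemma hook_sum_Suc:
  "hook_sum K i p L (Suc n) N b e =
     hook_sum K i p L n (N - 1) b e + hook_sum K i p L n N (b + 1) (e - N)"
proof -
  have "qbinom_coeff (Suc n) (N - K * m) (e - m * (p * (K * m + i) - K * b)) =
      qbinom_coeff n (N - 1 - K * m) (e - m * (p * (K * m + i) - K * b)) +
      qbinom_coeff n (N - K * m) (e - N - m * (p * (K * m + i) - K * (b + 1)))" for m
    by (simp add: qbinom_coeff.simps(2) algebra_simps)
  moreover have "qbinom_coeff (Suc n) (N - K * m + i) (e - (m * p - b) * (K * m - i)) =
      qbinom_coeff n (N - 1 - K * m + i) (e - (m * p - b) * (K * m - i)) +
      qbinom_coeff n (N - K * m + i) (e - N - (m * p - (b + 1)) * (K * m - i))" for m
    by (simp add: qbinom_coeff.simps(2) algebra_simps)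
  ultimately show ?thesis
    by (simp add: hook_sum_def sum.distrib[symmetric] algebra_simps)
qed

lemma hook_sum_Suc':
  "hook_sum K i p L (Suc n) N b e =
     hook_sum K i p L n N b e + hook_sum K i p L n (N - 1) (b - 1) (e - (int n + 1 - N))"
proof -
  have "qbinom_coeff (Suc n) (N - K * m) (e - m * (p * (K * m + i) - K * b)) =
      qbinom_coeff n (N - K * m) (e - m * (p * (K * m + i) - K * b)) +
      qbinom_coeff n (N - 1 - K * m) (e - (int n + 1 - N) - m * (p * (K * m + i) - K * (b - 1)))" for m
    by (simp add: qbinom_coeff_Suc' algebra_simps)
  moreover have "qbinom_coeff (Suc n) (N - K * m + i) (e - (m * p - b) * (K * m - i)) =
      qbinom_coeff n (N - K * m + i) (e - (m * p - b) * (K * m - i)) +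
      qbinom_coeff n (N - 1 - K * m + i) (e - (int n + 1 - N) - (m * p - (b - 1)) * (K * m - i))" for m
    by (simp add: qbinom_coeff_Suc' algebra_simps)
  ultimately show ?thesis
    by (simp add: hook_sum_def sum.distrib[symmetric] algebra_simps)
qed

text \<open>
  On the two walls of the strip the positive and negative terms cancel: the symmetry of the
  \<open>q\<close>-binomials matches the term for \<open>m\<close> of one sum with the term for \<open>- m\<close> of the other (lower wall)
  or for \<open>1 - m\<close> (upper wall).
\<close>

lemma hook_sum_lower_wall:
  assumes "2 * N - int n = - i"
  shows "hook_sum K i p L n N 0 e = 0"
proof -
  have eq: "qbinom_coeff n (N + K * m + i) (e - (m * p) * (K * m + i)) =
      qbinom_coeff n (N - K * m) (e - m * (p * (K * m + i)))" for m
  proof -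
    have "N + K * m + i = int n - (N - K * m)" using assms by simp
    then show ?thesis by (simp only: qbinom_coeff_symmetric) (simp add: algebra_simps)
  qed
  have "(\<Sum>m = -int L..int L. qbinom_coeff n (N - K * m + i) (e - (m * p) * (K * m - i))) =
      (\<Sum>m = -int L..int L. qbinom_coeff n (N + K * m + i) (e - (m * p) * (K * m + i)))"
    by (rule sum.reindex_bij_witness[of _ uminus uminus]) (auto simp: algebra_simps)
  then show ?thesis by (simp add: hook_sum_def sum_subtractf eq)
qed

lemma hook_sum_upper_wall:
  assumes "2 * N - int n = K - i" "0 < i" "i < K" "n \<le> L"
  shows "hook_sum K i p L n N p e = 0"
proof -
  define F where "F = (\<lambda>m. qbinom_coeff n (N - K * m) (e - m * (p * (K * m + i) - K * p)))"
  have eq: "qbinom_coeff n (N - K * (1 - m) + i) (e - ((1 - m) * p - p) * (K * (1 - m) - i)) = F m" for m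
  proof -
    have "N - K * (1 - m) + i = int n - (N - K * m)" using assms(1) by (simp add: algebra_simps)
    then show ?thesis by (simp only: qbinom_coeff_symmetric F_def) (simp add: algebra_simps)
  qed
  \<comment> \<open>The map \<open>m \<mapsto> 1 - m\<close> does not preserve the range of summation; the boundary terms vanish.\<close>
  have Lb: "K * int L \<ge> int L" using assms by (simp add: mult_le_cancel_right1)
  have z1: "F (- int L) = 0" and z2: "F (int L + 1) = 0"
    unfolding F_def using Lb assms
    by (intro qbinom_coeff_outside; simp add: algebra_simps)+
  have "(\<Sum>m = -int L..int L. qbinom_coeff n (N - K * m + i) (e - (m * p - p) * (K * m - i))) =
      (\<Sum>m = 1 - int L..int L + 1. F m)"
    by (rule sum.reindex_bij_witness[of _ "\<lambda>m. 1 - m" "\<lambda>m. 1 - m"]) (auto simp flip: eq)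
  also have "\<dots> = (\<Sum>m = -int L..int L + 1. F m)"
  proof (rule sum.mono_neutral_left)
    have "m = - int L" if "m \<in> {- int L..int L + 1} - {1 - int L..int L + 1}" for m
      using that by auto
    then show "\<forall>m\<in>{- int L..int L + 1} - {1 - int L..int L + 1}. F m = 0"
      using z1 by blast
  qed auto
  also have "\<dots> = (\<Sum>m = -int L..int L. F m)"
  proof (rule sum.mono_neutral_right)
    have "m = int L + 1" if "m \<in> {- int L..int L + 1} - {- int L..int L}" for m
      using that by auto
    then show "\<forall>m\<in>{- int L..int L + 1} - {- int L..int L}. F m = 0"
      using z2 by blast
  qed auto
  finally show ?thesis by (simp add: hook_sum_def sum_subtractf F_def)
qed

text \<open>
  For \<open>n = 0\<close> the strip excludes every negative term: such a term would need \<open>K m = N + i\<close>, which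
  lies strictly between \<open>0\<close> and \<open>K\<close>.
\<close>

lemma hook_sum_0:
  assumes "0 < i" "i < K" "0 \<le> b" "b \<le> p" "b - i \<le> 2 * N" "2 * N \<le> K - i - (p - b)"
  shows "0 \<le> hook_sum K i p L 0 N b e"
proof -
  have "N - K * m + i \<noteq> 0" for m
  proof
    assume "N - K * m + i = 0"
    then have "2 * (K * m) = 2 * N + 2 * i" by simp
    with assms have "0 < K * m" "K * m < K * 1" by linarith+
    moreover have "0 < K" using assms by linarith
    ultimately have "0 < m" "m < 1"
      by (simp_all add: zero_less_mult_iff mult_less_cancel_left_pos)
    then show False by simp
  qed
  then show ?thesis unfolding hook_sum_def by (intro sum_nonneg) auto
qed

text \<open>
  The point \<open>(b, 2 N - n)\<close> moves in the strip \<open>b - i \<le> 2 N - n \<le> K - i - (p - b)\<close>, \<open>0 \<le> b \<le> p\<close>, as \<open>n\<close>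
  decreases. The first recurrence stays inside unless \<open>b = p\<close> or the point lies on the lower
  boundary, the second unless \<open>b = 0\<close> or the point lies on the upper boundary. Since \<open>p < K\<close>, the
  two boundaries are disjoint, so the only points where neither applies are the walls.
\<close>

theorem hook_sum_nonneg:
  assumes "0 < i" "i < K" "0 < p" "p < K" "0 \<le> b" "b \<le> p"
    and "b - i \<le> 2 * N - int n" "2 * N - int n \<le> K - i - (p - b)" "n \<le> L"
  shows "0 \<le> hook_sum K i p L n N b e"
  using assms(5-)
proof (induction n arbitrary: N b e)
  case 0
  then show ?case using assms(1,2) hook_sum_0 by simp
next
  case (Suc n)
  note IH = Suc.IH
  have 1: ?case if "b < p" "b - i < 2 * N - int (Suc n)"
  proof -
    have "0 \<le> hook_sum K i p L n (N - 1) b e" "0 \<le> hook_sum K i p L n N (b + 1) (e - N)"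
      using Suc.prems that by (auto intro!: IH)
    then show ?thesis by (simp add: hook_sum_Suc)
  qed
  have 2: ?case if "0 < b" "2 * N - int (Suc n) < K - i - (p - b)"
  proof -
    have "0 \<le> hook_sum K i p L n N b e"
        "0 \<le> hook_sum K i p L n (N - 1) (b - 1) (e - (int n + 1 - N))"
      using Suc.prems that by (auto intro!: IH)
    then show ?thesis by (simp add: hook_sum_Suc')
  qed
  have 3: ?case if "b = 0" "2 * N - int (Suc n) = - i"
    using that hook_sum_lower_wall[of N "Suc n" i K p L e] by simp
  have 4: ?case if "b = p" "2 * N - int (Suc n) = K - i"
    using that assms Suc.prems hook_sum_upper_wall[of N "Suc n" K i L p e] by simp
  have "b < p \<and> b - i < 2 * N - int (Suc n) \<or> 0 < b \<and> 2 * N - int (Suc n) < K - i - (p - b) \<or>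
      b = 0 \<and> 2 * N - int (Suc n) = - i \<or> b = p \<and> 2 * N - int (Suc n) = K - i"
    using Suc.prems assms(3,4) by linarith
  then show ?case using 1 2 3 4 by blast
qed

text \<open>
  The number of partitions of \<open>e\<close>, as the stable value of the coefficient of \<open>q\<^sup>e\<close> in \<open>[n, k]\<^sub>q\<close>; any
  \<open>n\<close> and \<open>k\<close> with \<open>e \<le> k\<close> and \<open>e \<le> n - k\<close> would give the same number.
\<close>

definition partition_count :: "int \<Rightarrow> int" where
  "partition_count e = qbinom_coeff (nat (2 * e)) e e"

lemma partition_count_neg: "e < 0 \<Longrightarrow> partition_count e = 0"
  by (simp add: partition_count_def qbinom_coeff_neg)

lemma qbinom_coeff_stable:
  assumes "0 \<le> e \<Longrightarrow> e \<le> k" "0 \<le> e \<Longrightarrow> e \<le> int n - k"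
  shows "qbinom_coeff n k e = partition_count e"
proof (cases "e < 0")
  case True
  then show ?thesis by (simp add: qbinom_coeff_neg partition_count_neg)
next
  case False
  have 1: "qbinom_coeff (nat (2 * e) + x) (e + int x) e = partition_count e" for x
    by (induction x) (simp_all add: partition_count_def qbinom_coeff.simps(2) qbinom_coeff_neg)
  have 2: "qbinom_coeff (n' + y) k e = qbinom_coeff n' k e" if "e \<le> int n' - k" for n' y
  proof (induction y)
    case (Suc y)
    then show ?case using that
      by (simp add: qbinom_coeff_Suc' qbinom_coeff_neg)
  qed simp
  define x where "x = nat (k - e)"
  define y where "y = nat (int n - k - e)"
  have *: "n = nat (2 * e) + x + y" "k = e + int x"
    using assms False by (simp_all add: x_def y_def)
  have "e \<le> int (nat (2 * e) + x) - k" using * False by simp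
  from 2[OF this, of y] 1[of x] * show ?thesis by simp
qed

text \<open>
  Both families of exponents grow at least linearly, so that only finitely many terms contribute
  to a given coefficient.
\<close>

lemma abs_le_theta_exponents:
  fixes b i p K m :: int
  assumes "0 < b" "b < p" "0 < i" "i < K"
  shows "\<bar>m\<bar> \<le> m * (p * (K * m + i) - K * b)"
    and "\<bar>m\<bar> \<le> (m * p - b) * (K * m - i)"
proof -
  have "\<bar>m\<bar> \<le> m * (p * (K * m + i) - K * b) \<and> \<bar>m\<bar> \<le> (m * p - b) * (K * m - i)"
  proof (cases "m \<le> 0")
    case True
    define t where "t = - m"
    have t: "m = - t" "0 \<le> t" using True by (simp_all add: t_def)
    have "t \<le> t * (p * (K * t - i) + K * b)"
    proof (cases "t = 0")
      case False
      then have "1 \<le> t" using t by simp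
      then have "K * 1 \<le> K * t" using assms by (intro mult_left_mono) auto
      then have "0 \<le> K * t - i" using assms by linarith
      then have "0 \<le> p * (K * t - i)" using assms by (intro mult_nonneg_nonneg) auto
      moreover have "0 < K * b" using assms by simp
      ultimately have "1 \<le> p * (K * t - i) + K * b" by linarith
      then show ?thesis using t by (simp add: mult_le_cancel_left1)
    qed simp
    moreover have "t * 1 \<le> (t * p + b) * (K * t + i)"
    proof (intro mult_mono)
      have "t * 1 \<le> t * p" using assms t by (intro mult_left_mono) auto
      then show "t \<le> t * p + b" using assms by simp
      have "0 \<le> K * t" using assms t by simp
      then show "1 \<le> K * t + i" using assms by linarith
    qed (use assms t in auto)
    ultimately show ?thesis using t by (simp add: algebra_simps)
  next
    case False
    then have m: "1 \<le> m" by simp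
    have pm: "p * 1 \<le> p * m" and Km: "K * 1 \<le> K * m"
      using assms m by (intro mult_left_mono; simp)+
    have "1 \<le> p * m - b" using assms pm by linarith
    then have "1 * 1 \<le> K * (p * m - b)" using assms by (intro mult_mono) auto
    moreover have "0 < p * i" using assms by simp
    ultimately have "1 \<le> p * (K * m + i) - K * b" by (simp add: algebra_simps)
    then have "m \<le> m * (p * (K * m + i) - K * b)" using m by (simp add: mult_le_cancel_left1)
    moreover have "m * 1 \<le> (m * p - b) * (K * m - i)"
    proof (intro mult_mono)
      have "(m - 1) * 1 \<le> (m - 1) * p" using assms m by (intro mult_left_mono) auto
      then have "m \<le> m * p - p + 1" by (simp add: algebra_simps)
      then show "m \<le> m * p - b" using assms by linarith
      then show "0 \<le> m * p - b" using m by linarith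
      show "1 \<le> K * m - i" using assms Km by linarith
    qed simp
    ultimately show ?thesis using m by simp
  qed
  then show "\<bar>m\<bar> \<le> m * (p * (K * m + i) - K * b)" "\<bar>m\<bar> \<le> (m * p - b) * (K * m - i)" by blast+
qed

text \<open>
  The limit of \<open>hook_sum_nonneg\<close> as \<open>n\<close> grows along the line \<open>2 N - n = b - i\<close>, which lies in the
  strip; every \<open>q\<close>-binomial coefficient that occurs reaches its stable value.
\<close>

lemma virasoro_coeff_nonneg_less:
  fixes b i p K M :: int
  assumes "0 < b" "b < p" "0 < i" "i < K" "p < K" and L: "M \<le> int L"
  shows "0 \<le> (\<Sum>l = -int L..int L. partition_count (M - l * (K * p * l + K * b - i * p))
            - partition_count (M - (p * l + b) * (K * l + i)))"
proof -
  define M' where "M' = max M 0"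
  \<comment> \<open>Only \<open>\<bar>m\<bar> \<le> M'\<close> contributes, and \<open>N\<close> is large enough for all these terms to be stable.\<close>
  define N where "N = (K + 1) * M' + K"
  define f where "f = (\<lambda>m. partition_count (M - m * (p * (K * m + i) - K * b))
            - partition_count (M - (m * p - b) * (K * m - i)))"
  have "0 \<le> K * M'" "0 \<le> M'" "M \<le> M'" using assms by (simp_all add: M'_def)
  note M' = this
  have N: "N = K * M' + M' + K" by (simp add: N_def algebra_simps)
  define n0 where "n0 = nat (2 * N - (b - i))"
  have "0 \<le> 2 * N - (b - i)" using M' N assms by linarith
  then have n0: "int n0 = 2 * N - (b - i)" by (simp add: n0_def)
  have Km: "\<bar>K * m\<bar> \<le> K * M'" if "\<bar>m\<bar> \<le> x" "0 \<le> M - x" for m x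
  proof -
    have "K * \<bar>m\<bar> \<le> K * M'" using that assms M' by (intro mult_left_mono) auto
    then show ?thesis using assms by (simp add: abs_mult)
  qed
  define L' where "L' = n0 + L"
  have "0 \<le> hook_sum K i p L' n0 N b M"
    using assms by (intro hook_sum_nonneg) (auto simp: n0 L'_def)
  also have "hook_sum K i p L' n0 N b M = (\<Sum>m = -int L'..int L'. f m)"
  proof -
    have 1: "qbinom_coeff n0 (N - K * m) (M - x) = partition_count (M - x)"
      "qbinom_coeff n0 (N - K * m + i) (M - x) = partition_count (M - x)" if "\<bar>m\<bar> \<le> x" for m x
    proof -
      have "K * m \<le> K * M'" "- (K * M') \<le> K * m" "0 \<le> x" if "0 \<le> M - x"
        using Km[OF \<open>\<bar>m\<bar> \<le> x\<close> that] \<open>\<bar>m\<bar> \<le> x\<close> by (simp_all add: abs_le_iff)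
      then have "M - x \<le> N - K * m" "M - x \<le> int n0 - (N - K * m)"
          "M - x \<le> N - K * m + i" "M - x \<le> int n0 - (N - K * m + i)" if "0 \<le> M - x"
        using that M'(2,3) N n0 assms(1-5) by (simp; linarith)+
      then show "qbinom_coeff n0 (N - K * m) (M - x) = partition_count (M - x)"
        "qbinom_coeff n0 (N - K * m + i) (M - x) = partition_count (M - x)"
        by (intro qbinom_coeff_stable; blast)+
    qed
    then show ?thesis
      unfolding hook_sum_def f_def
      by (intro sum.cong arg_cong2[where f="(-)"] 1 abs_le_theta_exponents assms refl)
  qed
  also have "\<dots> = (\<Sum>m = -int L..int L. f m)"
  proof (rule sum.mono_neutral_right)
    show "\<forall>m\<in>{- int L'..int L'} - {- int L..int L}. f m = 0"
    proof
      fix m assume "m \<in> {- int L'..int L'} - {- int L..int L}"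
      then have "M < \<bar>m\<bar>" using L by auto
      then show "f m = 0"
        using abs_le_theta_exponents[OF assms(1-4), of m]
        by (simp add: f_def partition_count_neg)
    qed
  qed (auto simp: L'_def)
  also have "\<dots> = (\<Sum>l = -int L..int L. partition_count (M - l * (K * p * l + K * b - i * p))
            - partition_count (M - (p * l + b) * (K * l + i)))"
    by (rule sum.reindex_bij_witness[of _ uminus uminus]) (auto simp: f_def algebra_simps)
  finally show ?thesis .
qed

text \<open>
  The sum is symmetric under exchanging \<open>(r, p)\<close> and \<open>(s, p')\<close>, so either of \<open>p\<close> and \<open>p'\<close> may be the
  larger one.
\<close>

theorem virasoro_coeff_nonneg:
  fixes r s p p' M :: int
  assumes "0 < r" "r < p" "0 < s" "s < p'" "p \<noteq> p'" and L: "M \<le> int L"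
  shows "0 \<le> (\<Sum>l = -int L..int L. partition_count (M - l * (p * p' * l + r * p' - s * p))
            - partition_count (M - (p * l + r) * (p' * l + s)))"
proof (cases "p < p'")
  case True
  then show ?thesis using virasoro_coeff_nonneg_less[OF assms(1-4) _ L]
    by (simp add: algebra_simps)
next
  case False
  have "(\<Sum>l = -int L..int L. partition_count (M - l * (p' * p * l + p * s - r * p'))) =
      (\<Sum>l = -int L..int L. partition_count (M - l * (p * p' * l + r * p' - s * p)))"
    by (rule sum.reindex_bij_witness[of _ uminus uminus]) (auto simp: algebra_simps)
  then show ?thesis using False assms virasoro_coeff_nonneg_less[OF assms(3,4,1,2) _ L]
    by (simp add: algebra_simps sum_subtractf)
qed

section \<open>The Jacobi triple product\<close>

text \<open>
  Congruence modulo \<open>q\<^bsup>m+1\<^esup>\<close>. Infinite products are compared through their partial products in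
  this relation, which is compatible with multiplication.
\<close>

definition fps_agree :: "nat \<Rightarrow> 'a::zero fps \<Rightarrow> 'a fps \<Rightarrow> bool" where
  "fps_agree m f g \<longleftrightarrow> (\<forall>x\<le>m. fps_nth f x = fps_nth g x)"

lemma fps_agree_mult:
  fixes f g :: "'a::comm_ring_1 fps"
  assumes "fps_agree m f g" "fps_agree m f' g'"
  shows "fps_agree m (f * f') (g * g')"
  using assms by (auto simp: fps_agree_def fps_mult_nth intro!: sum.cong)

lemma fps_agree_trans: "fps_agree m f g \<Longrightarrow> fps_agree m g h \<Longrightarrow> fps_agree m f h"
  and fps_agree_sym: "fps_agree m f g \<Longrightarrow> fps_agree m g f"
  by (auto simp: fps_agree_def)

lemma fps_eqI_agree: "(\<And>m. fps_agree m f g) \<Longrightarrow> f = g"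
  by (auto simp: fps_agree_def fps_eq_iff)

lemma fps_agree_prod_1:
  fixes f :: "nat \<Rightarrow> 'a::comm_ring_1 fps"
  assumes "\<And>i. i \<in> A \<Longrightarrow> fps_agree m (f i) 1"
  shows "fps_agree m (prod f A) 1"
  using assms
proof (induction A rule: infinite_finite_induct)
  case (insert x A)
  then have "fps_agree m (f x * prod f A) (1 * 1)" by (intro fps_agree_mult) auto
  with insert show ?case by simp
qed (auto simp: fps_agree_def)

lemma eventually_qpoch_agree:
  fixes us :: "'a::comm_ring_1 fps list"
  assumes "\<And>u. u \<in> set us \<Longrightarrow> fps_nth u 0 = 0" and "fps_nth v 0 = 0"
  shows "eventually (\<lambda>N. fps_agree m (\<Prod>i<N. \<Prod>u\<leftarrow>us. 1 - u * v ^ i) (qpoch us v)) sequentially"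
proof -
  have "fps_nth (\<Prod>u\<leftarrow>us. 1 - u * v ^ i) 0 = 1" for i
    using assms(1) by (rule fps_prod_list_one_minus_nth_0)
  then have "(\<Prod>u\<leftarrow>us. 1 - u * v ^ i) \<noteq> 0" for i
    by (metis fps_zero_nth zero_neq_one)
  then have "(\<lambda>N. \<Prod>i\<le>N. \<Prod>u\<leftarrow>us. 1 - u * v ^ i) \<longlonglongrightarrow> qpoch us v"
    using qpoch_has_prod[of us v] assms by (auto simp: has_prod_def raw_has_prod_def)
  then have "(\<lambda>N. \<Prod>i<Suc N. \<Prod>u\<leftarrow>us. 1 - u * v ^ i) \<longlonglongrightarrow> qpoch us v"
    by (simp only: lessThan_Suc_atMost)
  then have "(\<lambda>N. \<Prod>i<N. \<Prod>u\<leftarrow>us. 1 - u * v ^ i) \<longlonglongrightarrow> qpoch us v"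
    by (rule LIMSEQ_imp_Suc)
  then have *: "eventually (\<lambda>N. fps_nth (\<Prod>i<N. \<Prod>u\<leftarrow>us. 1 - u * v ^ i) x = fps_nth (qpoch us v) x) sequentially" for x
    unfolding tendsto_fps_iff by blast
  have "eventually (\<lambda>N. \<forall>x\<in>{..m}. fps_nth (\<Prod>i<N. \<Prod>u\<leftarrow>us. 1 - u * v ^ i) x = fps_nth (qpoch us v) x) sequentially"
    by (intro eventually_ball_finite) (auto simp: *)
  then show ?thesis by (simp add: fps_agree_def Ball_def)
qed

definition qbinom_fps :: "nat \<Rightarrow> nat \<Rightarrow> int \<Rightarrow> 'a::comm_ring_1 fps" where
  "qbinom_fps w n k =
     Abs_fps (\<lambda>e. if w dvd e then of_int (qbinom_coeff n k (int (e div w))) else 0)"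

definition partition_fps :: "nat \<Rightarrow> 'a::comm_ring_1 fps" where
  "partition_fps w =
     Abs_fps (\<lambda>e. if w dvd e then of_int (partition_count (int (e div w))) else 0)"

lemma qbinom_fps_outside: "k < 0 \<or> int n < k \<Longrightarrow> qbinom_fps w n k = 0"
  by (simp add: qbinom_fps_def qbinom_coeff_outside fps_eq_iff)

lemma qbinom_fps_0: "0 < w \<Longrightarrow> qbinom_fps w n 0 = 1"
proof -
  assume "0 < w"
  have "qbinom_coeff n 0 e = (if e = 0 then 1 else 0)" for e
    by (induction n) (auto simp: qbinom_coeff.simps(2) qbinom_coeff_outside)
  then show ?thesis using \<open>0 < w\<close> by (auto simp: qbinom_fps_def fps_eq_iff elim!: dvdE)
qed

lemma qbinom_fps_shift_nth:
  fixes w t n :: nat and k :: int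
  assumes "0 < w"
  shows "fps_nth (fps_X ^ (w * t) * qbinom_fps w n k :: 'a::comm_ring_1 fps) e =
    (if w dvd e then of_int (qbinom_coeff n k (int (e div w) - int t)) else 0)"
proof (cases "w dvd e")
  case True
  then obtain d where d: "e = w * d" by blast
  show ?thesis
  proof (cases "d < t")
    case True
    then show ?thesis using assms d by (simp add: fps_X_power_mult_nth qbinom_coeff_neg)
  next
    case False
    then have "w * d - w * t = w * (d - t)" "\<not> w * d < w * t" by (simp_all add: diff_mult_distrib2)
    then show ?thesis using assms d False
      by (simp add: fps_X_power_mult_nth qbinom_fps_def of_nat_diff)
  qed
next
  case False
  then have "\<not> w dvd e - w * t" if "w * t \<le> e"
    using that by (metis dvd_diffD dvd_triv_left)
  then show ?thesis using False
    by (auto simp: fps_X_power_mult_nth qbinom_fps_def not_less)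
qed

lemma qbinom_fps_Suc:
  assumes "0 < w"
  shows "qbinom_fps w (Suc n) k =
    qbinom_fps w n (k - 1) + fps_X ^ (w * nat k) * qbinom_fps w n k"
proof (cases "k < 0")
  case True
  then show ?thesis by (simp add: qbinom_fps_outside)
next
  case False
  then show ?thesis
    by (simp add: fps_eq_iff qbinom_fps_shift_nth[OF assms])
       (simp add: qbinom_fps_def qbinom_coeff.simps(2))
qed

lemma qbinom_fps_Suc':
  assumes "0 < w"
  shows "qbinom_fps w (Suc n) k =
    qbinom_fps w n k + fps_X ^ (w * nat (int n + 1 - k)) * qbinom_fps w n (k - 1)"
proof (cases "k > int n + 1")
  case True
  then show ?thesis by (simp add: qbinom_fps_outside)
next
  case False
  then show ?thesis
    by (simp add: fps_eq_iff qbinom_fps_shift_nth[OF assms])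
       (simp add: qbinom_fps_def qbinom_coeff_Suc')
qed

text \<open>
  Eliminating \<open>[n, k + 1]\<^sub>q\<close> from the two Pascal rules.
\<close>

lemma qbinom_fps_absorb:
  assumes "0 < w" "k \<le> n"
  shows "qbinom_fps w (Suc n) (int k + 1) * (1 - fps_X ^ (w * Suc k)) =
    qbinom_fps w n (int k) * (1 - fps_X ^ (w * Suc n) :: 'a::comm_ring_1 fps)"
proof -
  let ?X = "\<lambda>t. fps_X ^ (w * t) :: 'a fps"
  have 1: "qbinom_fps w (Suc n) (int k + 1) =
      qbinom_fps w n (int k) + ?X (Suc k) * qbinom_fps w n (int k + 1)"
    using qbinom_fps_Suc[OF assms(1), of n "int k + 1"] by (simp add: nat_add_distrib)
  have 2: "qbinom_fps w (Suc n) (int k + 1) =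
      qbinom_fps w n (int k + 1) + ?X (n - k) * qbinom_fps w n (int k)"
    using qbinom_fps_Suc'[OF assms(1), of n "int k + 1"] assms(2) by (simp add: nat_diff_distrib)
  have 3: "?X (Suc k) * ?X (n - k) = ?X (Suc n)"
  proof -
    have "w * Suc k + w * (n - k) = w * Suc n"
      using assms(2) by (simp flip: distrib_left)
    then show ?thesis by (simp only: power_add[symmetric])
  qed
  have "qbinom_fps w (Suc n) (int k + 1) * (1 - ?X (Suc k)) =
      qbinom_fps w n (int k) + ?X (Suc k) * qbinom_fps w n (int k + 1)
      - ?X (Suc k) * (qbinom_fps w n (int k + 1) + ?X (n - k) * qbinom_fps w n (int k))"
    using 1 2 by (simp only: right_diff_distrib mult_1_right) (simp only: mult.commute)
  also have "\<dots> = qbinom_fps w n (int k) * (1 - ?X (Suc n))"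
    by (simp only: 3[symmetric]) (simp add: algebra_simps)
  finally show ?thesis .
qed

lemma qbinom_fps_prod:
  assumes "0 < w" "k \<le> n"
  shows "qbinom_fps w n (int k) * (\<Prod>i<k. 1 - fps_X ^ (w * Suc i)) =
    (\<Prod>i<k. 1 - fps_X ^ (w * (n - i)) :: 'a::comm_ring_1 fps)"
  using assms(2)
proof (induction k arbitrary: n)
  case 0
  then show ?case using assms(1) by (simp add: qbinom_fps_0)
next
  case (Suc k)
  then obtain n' where n: "n = Suc n'" "k \<le> n'" by (cases n) auto
  have "qbinom_fps w n (int (Suc k)) * (\<Prod>i<Suc k. 1 - fps_X ^ (w * Suc i)) =
      (qbinom_fps w (Suc n') (int k + 1) * (1 - fps_X ^ (w * Suc k))) *
        (\<Prod>i<k. 1 - fps_X ^ (w * Suc i) :: 'a fps)"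
    by (simp only: n prod.lessThan_Suc) (simp add: algebra_simps)
  also have "\<dots> = (1 - fps_X ^ (w * Suc n')) * (\<Prod>i<k. 1 - fps_X ^ (w * (n' - i)))"
    unfolding qbinom_fps_absorb[OF assms(1) n(2)]
    by (simp only: Suc.IH[OF n(2), symmetric] ac_simps)
  also have "\<dots> = (\<Prod>i<Suc k. 1 - fps_X ^ (w * (n - i)))"
    by (simp only: prod.lessThan_Suc_shift n) simp
  finally show ?case .
qed

lemma qbinom_fps_agree_partition:
  assumes "int m \<le> k" "int m \<le> int n - k"
  shows "fps_agree m (qbinom_fps w n k) (partition_fps w)"
proof -
  have "qbinom_coeff n k (int (x div w)) = partition_count (int (x div w))" if "x \<le> m" for x
  proof -
    have "x div w \<le> x" by (rule div_le_dividend)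
    then show ?thesis using assms that by (intro qbinom_coeff_stable) linarith+
  qed
  then show ?thesis by (simp add: fps_agree_def qbinom_fps_def partition_fps_def)
qed

text \<open>
  The identity \<open>[n, k]\<^sub>q (q; q)\<^sub>k = (1 - q\<^sup>n) \<cdots> (1 - q\<^bsup>n-k+1\<^esup>)\<close> becomes this one as \<open>k\<close> and \<open>n - k\<close> grow:
  the right-hand side tends to 1.
\<close>

theorem qpoch_mult_partition_fps:
  assumes "0 < w"
  shows "qpoch [fps_X ^ w] (fps_X ^ w) * partition_fps w = (1 :: 'a::comm_ring_1 fps)"
proof (rule fps_eqI_agree)
  fix m
  let ?Q = "qpoch [fps_X ^ w] (fps_X ^ w) :: 'a fps"
  have "eventually (\<lambda>N. fps_agree m (\<Prod>i<N. 1 - fps_X ^ w * (fps_X ^ w) ^ i) ?Q) sequentially"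
    using eventually_qpoch_agree[of "[fps_X ^ w]" "fps_X ^ w :: 'a fps" m] assms by simp
  then obtain N where N: "\<And>k. N \<le> k \<Longrightarrow> fps_agree m (\<Prod>i<k. 1 - fps_X ^ w * (fps_X ^ w) ^ i) ?Q"
    by (auto simp: eventually_sequentially)
  define k where "k = max N m"
  define n where "n = Suc (k + m)"
  have 1: "fps_agree m (\<Prod>i<k. 1 - fps_X ^ (w * Suc i)) ?Q"
    using N[of k] by (simp add: k_def power_add power_mult)
  have 2: "fps_agree m (qbinom_fps w n (int k)) (partition_fps w :: 'a fps)"
    by (rule qbinom_fps_agree_partition) (auto simp: n_def k_def)
  have 3: "fps_agree m (\<Prod>i<k. 1 - fps_X ^ (w * (n - i))) (1 :: 'a fps)"
  proof (rule fps_agree_prod_1)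
    fix i assume "i \<in> {..<k}"
    then have "m < n - i" by (simp add: n_def)
    also have "n - i \<le> w * (n - i)" using assms by simp
    finally show "fps_agree m (1 - fps_X ^ (w * (n - i))) (1 :: 'a fps)"
      by (auto simp: fps_agree_def fps_X_power_nth)
  qed
  have "qbinom_fps w n (int k) * (\<Prod>i<k. 1 - fps_X ^ (w * Suc i)) =
      (\<Prod>i<k. 1 - fps_X ^ (w * (n - i)) :: 'a fps)"
    using assms by (intro qbinom_fps_prod) (auto simp: n_def)
  then show "fps_agree m (?Q * partition_fps w) 1"
    using fps_agree_mult[OF fps_agree_sym[OF 1] fps_agree_sym[OF 2]] 3
    by (auto simp: mult.commute intro: fps_agree_trans)
qed

definition alt :: "int \<Rightarrow> 'a::comm_ring_1" where
  "alt k = (if even k then 1 else - 1)"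

lemma alternating_term_shift:
  fixes x y z :: "'a::comm_ring_1"
  assumes "x * y = z * x'"
  shows "- a * x * y = - z * (a * x')"
  using assms by (simp add: mult.assoc mult.left_commute)

lemma alt_mult_cancel: "(alt k * e) * (alt k * x) = e * x"
  by (simp add: alt_def)

lemma int_interval_shift:
  fixes f :: "int \<Rightarrow> 'a::comm_monoid_add"
  shows "(\<Sum>m=0..int (Suc n). if m = 0 then 0 else f (m - 1)) = (\<Sum>m=0..int n. f m)"
proof -
  have "(\<Sum>m=0..int (Suc n). if m = 0 then 0 else f (m - 1)) = (\<Sum>m=1..int (Suc n). f (m - 1))"
    by (rule sum.mono_neutral_cong_right) auto
  also have "\<dots> = (\<Sum>m=0..int n. f m)"
    by (rule sum.reindex_bij_witness[of _ "\<lambda>m. m + 1" "\<lambda>m. m - 1"]) auto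
  finally show ?thesis .
qed

lemma int_interval_drop_last:
  fixes f :: "int \<Rightarrow> 'a::comm_monoid_add"
  assumes "f (int (Suc n)) = 0"
  shows "(\<Sum>m=0..int (Suc n). f m) = (\<Sum>m=0..int n. f m)"
proof -
  have "{0..int (Suc n)} = insert (int (Suc n)) {0..int n}" by auto
  then show ?thesis using assms by simp
qed

lemma finite_sublevel:
  fixes f :: "int \<Rightarrow> int"
  assumes "\<And>k. \<bar>k\<bar> \<le> f k"
  shows "finite {k. f k \<le> x \<and> P k}"
proof (rule finite_subset)
  show "{k. f k \<le> x \<and> P k} \<subseteq> {- x..x}"
  proof
    fix k assume "k \<in> {k. f k \<le> x \<and> P k}"
    then have "\<bar>k\<bar> \<le> x" using assms[of k] by simp
    then show "k \<in> {- x..x}" by auto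
  qed
qed simp

text \<open>
  The triple product sees \<open>E\<close> only through its increments and its value at 0. The lower
  bound keeps every sum over the integers locally finite.
\<close>

locale theta_exponent =
  fixes E :: "int \<Rightarrow> int" and u v w :: nat
  assumes E_0: "E 0 = 0"
    and E_step: "E (k + 1) = E k + int w * k + int u"
    and E_ge: "\<bar>k\<bar> \<le> E k"
    and uvw: "u + v = w" "0 < u" "0 < v"
begin

lemma E_nonneg: "0 \<le> E k" using E_ge[of k] by linarith

lemma w_pos: "0 < w" using uvw by simp

text \<open>
  For \<open>n = 2 N\<close> this is the finite triple product, which is obtained by raising \<open>n\<close> and
  \<open>N\<close>: either Pascal rule, followed by an index shift, multiplies this sum by a single factor.
\<close>

definition finite_theta :: "nat \<Rightarrow> nat \<Rightarrow> 'a::comm_ring_1 fps" where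
  "finite_theta n N = (\<Sum>m=0..int n.
     alt (m - int N) * fps_X ^ nat (E (m - int N)) * qbinom_fps w n m)"

lemma finite_theta_Suc:
  assumes "N \<le> n"
  shows "finite_theta (Suc n) N = (1 - fps_X ^ (u + w * (n - N)) :: 'a::comm_ring_1 fps) * finite_theta n N"
proof -
  let ?g = "\<lambda>m. alt (m - int N) * fps_X ^ nat (E (m - int N)) :: 'a fps"
  have shift: "?g (m + 1) * fps_X ^ (w * nat (int n - m)) = - (fps_X ^ (u + w * (n - N))) * ?g m"
    if "0 \<le> m" "m \<le> int n" for m
  proof -
    have "E (m + 1 - int N) + int w * (int n - m) = E (m - int N) + int (u + w * (n - N))"
    proof -
      have "int (w * (n - N)) = int w * (int n - int N)" using assms by (simp add: of_nat_diff)
      then show ?thesis using E_step[of "m - int N"] by (simp add: algebra_simps)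
    qed
    then have "int (nat (E (m + 1 - int N)) + w * nat (int n - m)) =
        int (nat (E (m - int N)) + (u + w * (n - N)))"
      using that E_nonneg by simp
    then have "nat (E (m + 1 - int N)) + w * nat (int n - m) =
        nat (E (m - int N)) + (u + w * (n - N))" by (simp only: of_nat_eq_iff)
    then have "fps_X ^ nat (E (m + 1 - int N)) * fps_X ^ (w * nat (int n - m)) =
        fps_X ^ (u + w * (n - N)) * (fps_X ^ nat (E (m - int N)) :: 'a fps)"
      by (simp only: power_add[symmetric] add.commute)
    moreover have "alt (m + 1 - int N) = - (alt (m - int N) :: 'a fps)"
      by (simp add: alt_def)
    ultimately show ?thesis by (simp only: alternating_term_shift)
  qed
  have "finite_theta (Suc n) N = (\<Sum>m=0..int (Suc n). ?g m * qbinom_fps w n m)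
      + (\<Sum>m=0..int (Suc n). ?g m * (fps_X ^ (w * nat (int n + 1 - m)) * qbinom_fps w n (m - 1)))"
    by (simp only: finite_theta_def qbinom_fps_Suc'[OF w_pos] distrib_left sum.distrib)
  also have "(\<Sum>m=0..int (Suc n). ?g m * qbinom_fps w n m) = finite_theta n N"
    unfolding finite_theta_def by (rule int_interval_drop_last) (simp add: qbinom_fps_outside)
  also have "(\<Sum>m=0..int (Suc n). ?g m * (fps_X ^ (w * nat (int n + 1 - m)) * qbinom_fps w n (m - 1)))
      = (\<Sum>m=0..int (Suc n). if m = 0 then 0 else
          (\<lambda>m. ?g (m + 1) * fps_X ^ (w * nat (int n - m)) * qbinom_fps w n m) (m - 1))"
    by (rule sum.cong) (auto simp: qbinom_fps_outside mult.assoc algebra_simps)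
  also have "\<dots> = (\<Sum>m=0..int n. ?g (m + 1) * fps_X ^ (w * nat (int n - m)) * qbinom_fps w n m)"
    by (rule int_interval_shift)
  also have "\<dots> = - (fps_X ^ (u + w * (n - N))) * finite_theta n N"
    unfolding finite_theta_def sum_distrib_left
    by (rule sum.cong) (auto simp only: shift mult.assoc[symmetric] atLeastAtMost_iff)
  finally show ?thesis by (simp add: algebra_simps)
qed

lemma finite_theta_Suc_Suc:
  "finite_theta (Suc n) (Suc N) = (1 - fps_X ^ (v + w * N) :: 'a::comm_ring_1 fps) * finite_theta n N"
proof -
  let ?g = "\<lambda>N m. alt (m - int N) * fps_X ^ nat (E (m - int N)) :: 'a fps"
  have shift: "?g (Suc N) m * fps_X ^ (w * nat m) = - (fps_X ^ (v + w * N)) * ?g N m"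
    if "0 \<le> m" for m
  proof -
    have "int w = int u + int v" using uvw by simp
    then have "E (m - int (Suc N)) + int w * m = E (m - int N) + int (v + w * N)"
      using E_step[of "m - int (Suc N)"] by (simp add: algebra_simps)
    then have "int (nat (E (m - int (Suc N))) + w * nat m) =
        int (nat (E (m - int N)) + (v + w * N))"
      using that E_nonneg by simp
    then have "nat (E (m - int (Suc N))) + w * nat m =
        nat (E (m - int N)) + (v + w * N)" by (simp only: of_nat_eq_iff)
    then have "fps_X ^ nat (E (m - int (Suc N))) * fps_X ^ (w * nat m) =
        fps_X ^ (v + w * N) * (fps_X ^ nat (E (m - int N)) :: 'a fps)"
      by (simp only: power_add[symmetric] add.commute)
    moreover have "alt (m - int (Suc N)) = - (alt (m - int N) :: 'a fps)"
      by (simp add: alt_def)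
    ultimately show ?thesis by (simp only: alternating_term_shift)
  qed
  have "finite_theta (Suc n) (Suc N) = (\<Sum>m=0..int (Suc n). ?g (Suc N) m * qbinom_fps w n (m - 1))
      + (\<Sum>m=0..int (Suc n). ?g (Suc N) m * (fps_X ^ (w * nat m) * qbinom_fps w n m))"
    by (simp only: finite_theta_def qbinom_fps_Suc[OF w_pos] distrib_left sum.distrib)
  also have "(\<Sum>m=0..int (Suc n). ?g (Suc N) m * qbinom_fps w n (m - 1)) =
      (\<Sum>m=0..int (Suc n). if m = 0 then 0 else (\<lambda>m. ?g N m * qbinom_fps w n m) (m - 1))"
    by (rule sum.cong) (auto simp: qbinom_fps_outside algebra_simps)
  also have "\<dots> = finite_theta n N"
    unfolding finite_theta_def by (rule int_interval_shift)
  also have "(\<Sum>m=0..int (Suc n). ?g (Suc N) m * (fps_X ^ (w * nat m) * qbinom_fps w n m)) =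
      (\<Sum>m=0..int n. ?g (Suc N) m * (fps_X ^ (w * nat m) * qbinom_fps w n m))"
    by (rule int_interval_drop_last) (simp add: qbinom_fps_outside)
  also have "\<dots> = - (fps_X ^ (v + w * N)) * finite_theta n N"
    unfolding finite_theta_def sum_distrib_left
    by (rule sum.cong) (auto simp only: mult.assoc[symmetric] shift atLeastAtMost_iff)
  finally show ?thesis by (simp add: algebra_simps)
qed

lemma finite_jacobi_triple_product:
  "finite_theta (2 * N) N =
     (\<Prod>i<N. (1 - fps_X ^ (u + w * i)) * (1 - fps_X ^ (v + w * i)) :: 'a::comm_ring_1 fps)"
proof (induction N)
  case 0
  show ?case by (simp add: finite_theta_def alt_def E_0 qbinom_fps_0[OF w_pos])
next
  case (Suc N)
  have "finite_theta (2 * Suc N) (Suc N) =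
      (1 - fps_X ^ (v + w * N)) * (finite_theta (Suc (2 * N)) N :: 'a fps)"
    using finite_theta_Suc_Suc[of "Suc (2 * N)" N] by simp
  also have "finite_theta (Suc (2 * N)) N =
      (1 - fps_X ^ (u + w * N)) * (finite_theta (2 * N) N :: 'a fps)"
    using finite_theta_Suc[of N "2 * N"] by (simp add: mult_2)
  finally show ?case by (simp only: Suc.IH prod.lessThan_Suc) (simp only: ac_simps)
qed

definition theta :: "'a::comm_ring_1 fps" where
  "theta = Abs_fps (\<lambda>j. \<Sum>k | E k = int j. alt k)"

lemma finite_E_le: "finite {k. E k \<le> x \<and> P k}"
  using E_ge by (rule finite_sublevel)

lemma theta_mult_nth:
  "fps_nth (theta * F :: 'a::comm_ring_1 fps) j =
     (\<Sum>k | E k \<le> int j. alt k * fps_nth F (j - nat (E k)))"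
proof -
  let ?S = "{k. E k \<le> int j}"
  have fin: "finite ?S" using finite_E_le[of "int j" "\<lambda>_. True"] by simp
  have "fps_nth (theta * F) j =
      (\<Sum>i=0..j. \<Sum>k | k \<in> ?S \<and> nat (E k) = i. alt k * fps_nth F (j - nat (E k)))"
    unfolding fps_mult_nth
  proof (rule sum.cong)
    fix i assume i: "i \<in> {0..j}"
    have "{k. k \<in> ?S \<and> nat (E k) = i} = {k. E k = int i}"
      using i E_nonneg by auto
    then show "fps_nth theta i * fps_nth F (j - i) =
        (\<Sum>k | k \<in> ?S \<and> nat (E k) = i. alt k * fps_nth F (j - nat (E k)))"
      using i by (simp add: theta_def sum_distrib_right)
  qed simp
  also have "\<dots> = (\<Sum>k\<in>?S. alt k * fps_nth F (j - nat (E k)))"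
    using fin by (intro sum.group) auto
  finally show ?thesis by simp
qed

lemma finite_theta_agree:
  assumes "2 * j \<le> N"
  shows "fps_agree j (finite_theta (2 * N) N) (theta * partition_fps w :: 'a::comm_ring_1 fps)"
  unfolding fps_agree_def
proof (intro allI impI)
  fix x assume x: "x \<le> j"
  have alt_mult: "alt k = (fps_const (alt k) :: 'a fps)" for k
    by (simp add: alt_def flip: fps_const_neg)
  have "fps_nth (finite_theta (2 * N) N :: 'a fps) x =
      (\<Sum>m=0..int (2 * N). if int x < E (m - int N) then 0 else
         alt (m - int N) * fps_nth (qbinom_fps w (2 * N) m) (x - nat (E (m - int N))))"
    unfolding finite_theta_def fps_sum_nth alt_mult
    by (rule sum.cong)
       (auto simp: mult.assoc fps_X_power_mult_nth)
  also have "\<dots> = (\<Sum>k=-int N..int N. if int x < E k then 0 else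
         alt k * fps_nth (qbinom_fps w (2 * N) (int N + k)) (x - nat (E k)))"
    by (rule sum.reindex_bij_witness[of _ "\<lambda>k. int N + k" "\<lambda>m. m - int N"]) auto
  also have "\<dots> = (\<Sum>k | E k \<le> int x. alt k * fps_nth (partition_fps w) (x - nat (E k)))"
  proof (rule sum.mono_neutral_cong_right)
    have k: "\<bar>k\<bar> \<le> int j" if "E k \<le> int x" for k
      using E_ge[of k] that x by linarith
    show "{k. E k \<le> int x} \<subseteq> {- int N..int N}"
    proof
      fix k assume "k \<in> {k. E k \<le> int x}"
      then show "k \<in> {- int N..int N}" using k[of k] assms by auto
    qed
    fix k assume "k \<in> {k. E k \<le> int x}"
    then have E: "E k \<le> int x" by simp
    then have "fps_agree j (qbinom_fps w (2 * N) (int N + k)) (partition_fps w :: 'a fps)"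
      using k[of k] assms by (intro qbinom_fps_agree_partition) auto
    then show "(if int x < E k then 0 else
         alt k * fps_nth (qbinom_fps w (2 * N) (int N + k)) (x - nat (E k))) =
         alt k * (fps_nth (partition_fps w) (x - nat (E k)) :: 'a)"
      using E x by (simp add: fps_agree_def)
  qed auto
  finally show "fps_nth (finite_theta (2 * N) N :: 'a fps) x = fps_nth (theta * partition_fps w) x"
    by (simp add: theta_mult_nth)
qed

theorem jacobi_triple_product:
  "qpoch [fps_X ^ u, fps_X ^ v, fps_X ^ w] (fps_X ^ w) = (theta :: 'a::comm_ring_1 fps)"
proof (rule fps_eqI_agree)
  fix j
  let ?P = "qpoch [fps_X ^ u, fps_X ^ v, fps_X ^ w] (fps_X ^ w) :: 'a fps"
  let ?Q = "qpoch [fps_X ^ w] (fps_X ^ w) :: 'a fps"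
  have X: "fps_X ^ a * (fps_X ^ w) ^ i = (fps_X ^ (a + w * i) :: 'a fps)" for a i
    by (simp add: power_add power_mult)
  have "eventually (\<lambda>N. fps_agree j (\<Prod>i<N. \<Prod>u\<leftarrow>[fps_X ^ u, fps_X ^ v, fps_X ^ w]. 1 - u * (fps_X ^ w) ^ i) ?P) sequentially"
    using uvw by (intro eventually_qpoch_agree) auto
  moreover have "eventually (\<lambda>N. fps_agree j (\<Prod>i<N. \<Prod>u\<leftarrow>[fps_X ^ w]. 1 - u * (fps_X ^ w) ^ i) ?Q) sequentially"
    using uvw by (intro eventually_qpoch_agree) auto
  moreover have "eventually (\<lambda>N. 2 * j \<le> N) sequentially"
    by (rule eventually_ge_at_top)
  ultimately have "eventually (\<lambda>N. fps_agree j ?P theta) sequentially"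
  proof eventually_elim
    case (elim N)
    have "(\<Prod>i<N. \<Prod>u\<leftarrow>[fps_X ^ u, fps_X ^ v, fps_X ^ w]. 1 - u * (fps_X ^ w) ^ i) =
        finite_theta (2 * N) N * (\<Prod>i<N. \<Prod>u\<leftarrow>[fps_X ^ w]. 1 - u * (fps_X ^ w) ^ i :: 'a fps)"
      by (simp add: finite_jacobi_triple_product X prod.distrib[symmetric] mult.assoc)
    then have "fps_agree j (\<Prod>i<N. \<Prod>u\<leftarrow>[fps_X ^ u, fps_X ^ v, fps_X ^ w]. 1 - u * (fps_X ^ w) ^ i)
        (theta * partition_fps w * ?Q)"
      using fps_agree_mult[OF finite_theta_agree[OF elim(3)] elim(2)] by simp
    moreover have "partition_fps w * ?Q = 1"
      by (subst mult.commute) (rule qpoch_mult_partition_fps[OF w_pos])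
    then have "theta * partition_fps w * ?Q = theta"
      by (simp only: mult.assoc mult_1_right)
    ultimately show ?case using fps_agree_trans[OF fps_agree_sym[OF elim(1)]] by simp
  qed
  then show "fps_agree j ?P theta" by simp
qed

end

section \<open>Contribution of a pair of residue classes\<close>

locale theta_quotient =
  fixes a B c n :: int
  assumes a_c: "0 < c" "c < a" "odd a" "odd c" and B_pos: "0 < B" and n_pos: "0 < n"
    and coprime_ac: "coprime a c" and coprime_Bn: "coprime B n"
begin

definition E :: "int \<Rightarrow> int" where
  "E k = B * (k * (a * k - c) div 2)"

lemma two_E: "2 * E k = B * (k * (a * k - c))"
proof -
  have "even (k * (a * k - c))" using a_c by auto
  then show ?thesis by (simp add: E_def)
qed

lemma E_step: "E (k + 1) = E k + B * a * k + B * ((a - c) div 2)"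
proof -
  have "2 * E (k + 1) = 2 * (E k + B * a * k + B * ((a - c) div 2))"
    using a_c by (simp add: two_E distrib_left mult.left_commute[of 2]) (simp add: algebra_simps)
  then show ?thesis by simp
qed

lemma E_ge: "\<bar>k\<bar> \<le> E k"
proof -
  have ac: "a \<ge> c + 2" using a_c by presburger
  have "2 * \<bar>k\<bar> \<le> k * (a * k - c)"
  proof (cases "k \<le> 0")
    case True
    have "- k * 2 \<le> - k * (a * - k + c)" if "k \<noteq> 0"
    proof (rule mult_left_mono)
      have "a * 1 \<le> a * - k" using that True a_c by (intro mult_left_mono) auto
      then show "2 \<le> a * - k + c" using a_c ac by linarith
    qed (use True in auto)
    then show ?thesis using True by (cases "k = 0") (auto simp: algebra_simps)
  next
    case False
    have "k * 2 \<le> k * (a * k - c)"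
    proof (rule mult_left_mono)
      have "a * 1 \<le> a * k" using False a_c by (intro mult_left_mono) auto
      then show "2 \<le> a * k - c" using ac by linarith
    qed (use False in auto)
    then show ?thesis using False by simp
  qed
  also have "\<dots> \<le> B * (k * (a * k - c))"
  proof -
    have "0 \<le> k * (a * k - c)" using calculation by linarith
    then show ?thesis using B_pos by (simp add: mult_le_cancel_right1)
  qed
  finally show ?thesis by (simp flip: two_E)
qed

lemma finite_E_le: "finite {k. E k \<le> x \<and> P k}"
  using E_ge by (rule finite_sublevel)

lemma E_shift: "E (k + 2 * n * l) = E k + n * (l * (2 * a * n * B * l + B * (2 * a * k - c)))"
proof -
  have "2 * E (k + 2 * n * l) = 2 * (E k + n * (l * (2 * a * n * B * l + B * (2 * a * k - c))))"
    by (simp only: two_E distrib_left[of 2]) (simp add: algebra_simps)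
  then show ?thesis by simp
qed

text \<open>
  With \<open>R\<close> and \<open>S\<close> as the two factors of \<open>E k' - E k\<close>, replacing \<open>k'\<close> by \<open>k' + 2 n l\<close> adds \<open>p l\<close> to
  the first and \<open>p' l\<close> to the second. This produces the exponents \<open>(p l + R) (p' l + S)\<close>.
\<close>

lemma E_diff:
  assumes "B * (a * (k + k') - c) = p' * R" "a * B * (k' - k) = p * S" "p * p' = 2 * a * n * B"
  shows "E k' = E k + n * (R * S)"
proof -
  have "(2 * a * B) * (E k' - E k) = (a * B) * (2 * E k' - 2 * E k)" by (simp add: algebra_simps)
  also have "\<dots> = (a * B * (k' - k)) * (B * (a * (k + k') - c))"
    by (simp only: two_E) (simp add: algebra_simps)
  also have "\<dots> = (p * p') * (R * S)" unfolding assms(1,2) by simp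
  also have "\<dots> = (2 * a * B) * (n * (R * S))" unfolding assms(3) by simp
  finally show ?thesis using a_c B_pos by simp
qed

text \<open>
  The contribution to the coefficient of \<open>q\<^sup>j\<close> of one residue class of \<open>k\<close>, without its sign
  \<open>(-1)\<^sup>k\<close>, which is constant on the class.
\<close>

definition class_sum :: "int \<Rightarrow> int \<Rightarrow> int" where
  "class_sum j t = (\<Sum>k | E k \<le> j \<and> [k = t] (mod 2 * n). partition_count ((j - E k) div n))"

lemma class_sum_cong: "[t = t'] (mod 2 * n) \<Longrightarrow> class_sum j t = class_sum j t'"
  unfolding class_sum_def by (rule sum.cong) (auto intro: cong_trans cong_sym)

lemma class_sum_shift: "class_sum j (t + 2 * n * x) = class_sum j t"
  by (rule class_sum_cong) (simp add: cong_def)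

text \<open>
  Parametrised as \<open>t + 2 n l\<close>, the class can be summed over any sufficiently long symmetric interval,
  because \<open>partition_count\<close> vanishes at negative arguments.
\<close>

lemma class_sum_eq:
  assumes "j + \<bar>t\<bar> \<le> int L"
  shows "class_sum j t = (\<Sum>l=-int L..int L. partition_count ((j - E (t + 2 * n * l)) div n))"
proof -
  have inj: "inj_on (\<lambda>l. t + 2 * n * l) A" for A using n_pos by (auto simp: inj_on_def)
  have im: "{k. E k \<le> j \<and> [k = t] (mod 2 * n)} = (\<lambda>l. t + 2 * n * l) ` {l. E (t + 2 * n * l) \<le> j}"
  proof (intro equalityI subsetI)
    fix k assume k: "k \<in> {k. E k \<le> j \<and> [k = t] (mod 2 * n)}"
    then obtain l where "k = t + 2 * n * l"
      by (auto simp: cong_iff_dvd_diff algebra_simps elim!: dvdE) (metis add.commute diff_add_cancel)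
    then show "k \<in> (\<lambda>l. t + 2 * n * l) ` {l. E (t + 2 * n * l) \<le> j}" using k by auto
  qed (auto simp: cong_def)
  have "class_sum j t = (\<Sum>l | E (t + 2 * n * l) \<le> j. partition_count ((j - E (t + 2 * n * l)) div n))"
    unfolding class_sum_def im by (subst sum.reindex[OF inj]) simp
  also have "\<dots> = (\<Sum>l=-int L..int L. partition_count ((j - E (t + 2 * n * l)) div n))"
  proof (rule sum.mono_neutral_left)
    show "{l. E (t + 2 * n * l) \<le> j} \<subseteq> {- int L..int L}"
    proof
      fix l assume "l \<in> {l. E (t + 2 * n * l) \<le> j}"
      then have "\<bar>t + 2 * n * l\<bar> \<le> j" using E_ge[of "t + 2 * n * l"] by simp
      then have "\<bar>2 * n * l\<bar> \<le> j + \<bar>t\<bar>" by linarith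
      moreover have "1 * \<bar>l\<bar> \<le> \<bar>2 * n\<bar> * \<bar>l\<bar>" using n_pos by (intro mult_right_mono) auto
      ultimately have "\<bar>l\<bar> \<le> int L" using assms by (simp only: abs_mult)
      then show "l \<in> {- int L..int L}" by auto
    qed
    have "(j - E k) div n < 0" if "\<not> E k \<le> j" for k
      using that n_pos by (simp add: pos_imp_zdiv_neg_iff)
    then show "\<forall>l\<in>{- int L..int L} - {l. E (t + 2 * n * l) \<le> j}.
        partition_count ((j - E (t + 2 * n * l)) div n) = 0"
      by (auto intro!: partition_count_neg)
  qed simp
  finally show ?thesis .
qed

lemma class_sum_diff_nonneg:
  assumes kk: "B * (a * (k + k') - c) = p' * R" "a * B * (k' - k) = p * S"
    and pp: "p * p' = 2 * a * n * B" "p \<noteq> p'"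
    and range: "0 < R" "R < p" "0 < S" "S < p'"
    and j: "n dvd j - E k"
  shows "0 \<le> class_sum j k - class_sum j k'"
proof -
  obtain M where M: "j = E k + n * M" using j by (metis dvdE add.commute diff_add_cancel)
  define L where "L = nat (\<bar>j\<bar> + \<bar>k\<bar> + \<bar>k'\<bar> + \<bar>M\<bar>)"
  have 1: "(j - E (k + 2 * n * l)) div n = M - l * (p * p' * l + R * p' - S * p)" for l
  proof -
    have "R * p' - S * p = B * (2 * a * k - c)"
      using kk by (simp add: algebra_simps)
    then have "l * (2 * a * n * B * l + B * (2 * a * k - c)) = l * (p * p' * l + R * p' - S * p)"
      by (simp only: pp(1) add_diff_eq[symmetric])
    then have "j - E (k + 2 * n * l) = n * (M - l * (p * p' * l + R * p' - S * p))"
      by (simp only: M E_shift right_diff_distrib[of n])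
    then show ?thesis using n_pos by simp
  qed
  have 2: "(j - E (k' + 2 * n * l)) div n = M - (p * l + R) * (p' * l + S)" for l
  proof -
    have "E (k' + 2 * n * l) = E k + n * ((R + p * l) * (S + p' * l))"
    proof (rule E_diff)
      have "B * (a * (k + (k' + 2 * n * l)) - c) = B * (a * (k + k') - c) + (2 * a * n * B) * l"
        by (simp add: algebra_simps)
      then show "B * (a * (k + (k' + 2 * n * l)) - c) = p' * (R + p * l)"
        unfolding kk pp(1)[symmetric] by (simp add: algebra_simps)
      have "a * B * (k' + 2 * n * l - k) = a * B * (k' - k) + (2 * a * n * B) * l"
        by (simp add: algebra_simps)
      then show "a * B * (k' + 2 * n * l - k) = p * (S + p' * l)"
        unfolding kk pp(1)[symmetric] by (simp add: algebra_simps)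
    qed (rule pp)
    then have "j - E (k' + 2 * n * l) = n * (M - (p * l + R) * (p' * l + S))"
      unfolding M by (simp add: algebra_simps)
    then show ?thesis using n_pos by simp
  qed
  have "M \<le> int L" "j + \<bar>k\<bar> \<le> int L" "j + \<bar>k'\<bar> \<le> int L" by (auto simp: L_def)
  then show ?thesis
    using virasoro_coeff_nonneg[OF range pp(2), of M L]
    by (simp add: class_sum_eq[of _ _ L] 1 2 sum_subtractf)
qed

text \<open>
  Adding multiples of \<open>2 n\<close> to \<open>k\<close> and \<open>k'\<close> preserves the class sums; it moves \<open>(R, S)\<close> by
  \<open>(p, - p')\<close> and by \<open>(p, p')\<close>. Exchanging \<open>k\<close> and \<open>k'\<close> negates both \<open>S\<close> and the difference.
  Together these bring every \<open>(R, S)\<close> into the range of \<open>class_sum_diff_nonneg\<close>, and the parity of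
  \<open>R div p + S div p'\<close> tells whether an exchange is involved.
\<close>

theorem class_sum_diff_sign:
  assumes kk: "B * (a * (k + k') - c) = p' * R" "a * B * (k' - k) = p * S"
    and pp: "p * p' = 2 * a * n * B" "p \<noteq> p'" "0 < p" "0 < p'"
    and ndvd: "\<not> p dvd R" "\<not> p' dvd S"
    and j: "n dvd j - E k"
  shows "0 \<le> alt (R div p + S div p') * (class_sum j k - class_sum j k')"
proof -
  \<comment> \<open>Subtracting \<open>2 n x\<close> from \<open>k'\<close> puts \<open>S\<close> into range and turns \<open>R div p\<close> into \<open>z\<close>.\<close>
  define x where "x = S div p'"
  define z where "z = R div p - x"
  have alt: "alt (R div p + S div p') = (alt z :: int)" by (auto simp: z_def x_def alt_def)
  have "0 < S mod p'" "0 < R mod p"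
    using ndvd pp(3,4) by (simp_all add: dvd_eq_mod_eq_0 order_less_le)
  then have S: "0 < S - p' * x" "S - p' * x < p'" and R: "0 < R - p * (x + z)" "R - p * (x + z) < p"
    using pp(3,4) by (simp_all add: x_def z_def minus_mult_div_eq_mod)
  have j': "n dvd j - E (k + 2 * n * t)" "n dvd j - E (k' + 2 * n * t)" for t
  proof -
    have eq: "j - E (k + 2 * n * t) = (j - E k) - n * (t * (2 * a * n * B * t + B * (2 * a * k - c)))"
      by (simp add: E_shift)
    show "n dvd j - E (k + 2 * n * t)" unfolding eq by (rule dvd_diff[OF j dvd_triv_left])
    have eq: "j - E (k' + 2 * n * t) = (j - E k) - n * (R * S + t * (2 * a * n * B * t + B * (2 * a * k' - c)))"
      by (simp only: E_shift[of k'] E_diff[OF kk pp(1)] distrib_left[of n])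
    show "n dvd j - E (k' + 2 * n * t)" unfolding eq by (rule dvd_diff[OF j dvd_triv_left])
  qed
  have sum: "B * (a * ((k + 2 * n * t) + (k' + 2 * n * t')) - c) = p' * (R + p * (t + t'))" for t t'
  proof -
    have "B * (a * ((k + 2 * n * t) + (k' + 2 * n * t')) - c)
        = B * (a * (k + k') - c) + (2 * a * n * B) * (t + t')" by (simp add: algebra_simps)
    then show ?thesis unfolding kk pp(1)[symmetric] by (simp add: algebra_simps)
  qed
  have diff: "a * B * ((k' + 2 * n * t') - (k + 2 * n * t)) = p * (S + p' * (t' - t))" for t t'
  proof -
    have "a * B * ((k' + 2 * n * t') - (k + 2 * n * t))
        = a * B * (k' - k) + (2 * a * n * B) * (t' - t)" by (simp add: algebra_simps)
    then show ?thesis unfolding kk pp(1)[symmetric] by (simp add: algebra_simps)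
  qed
  show ?thesis
  proof (cases "even z")
    case True
    then obtain t where z: "z = 2 * t" by blast
    have "0 \<le> class_sum j (k + 2 * n * - t) - class_sum j (k' + 2 * n * (- t - x))"
      by (rule class_sum_diff_nonneg[OF _ _ pp(1,2) _ _ _ _ j'(1), of _ _ "R - p * (x + z)" "S - p' * x"])
         (use R S in \<open>simp_all only: sum diff\<close>, simp_all add: z algebra_simps)
    then show ?thesis using True by (simp only: class_sum_shift alt) (simp add: alt_def)
  next
    case False
    then obtain t where z: "z = 2 * t + 1" by (blast elim: oddE)
    let ?R = "R - p * (x + z)" and ?S = "p' - (S - p' * x)"
    have "0 \<le> class_sum j (k' + 2 * n * (- t - 1 - x)) - class_sum j (k + 2 * n * (- t))"
    proof (rule class_sum_diff_nonneg[OF _ _ pp(1,2) _ _ _ _ j'(2), of _ _ ?R ?S])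
      show "B * (a * ((k' + 2 * n * (- t - 1 - x)) + (k + 2 * n * (- t))) - c) = p' * ?R"
        using sum[of "- t" "- t - 1 - x"] by (simp add: z algebra_simps)
      show "a * B * ((k + 2 * n * (- t)) - (k' + 2 * n * (- t - 1 - x))) = p * ?S"
        using diff[of "- t - 1 - x" "- t"] by (simp add: z algebra_simps)
    qed (use R S in auto)
    then show ?thesis using False by (simp only: class_sum_shift alt) (simp add: alt_def)
  qed
qed

section \<open>Grouping the residue classes into pairs\<close>

definition coeff :: "int \<Rightarrow> int" where
  "coeff j = (\<Sum>k | E k \<le> j \<and> n dvd j - E k. alt k * partition_count ((j - E k) div n))"

text \<open>
  The set \<open>T\<close> is a system of representatives for the solutions \<open>k\<close> of \<open>E k \<equiv> j (mod n)\<close>.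
\<close>

lemma coeff_eq_class_sums:
  assumes "finite T"
    and incong: "\<And>t t'. t \<in> T \<Longrightarrow> t' \<in> T \<Longrightarrow> [t = t'] (mod 2 * n) \<Longrightarrow> t = t'"
    and classes: "\<And>k. n dvd j - E k \<longleftrightarrow> (\<exists>t\<in>T. [k = t] (mod 2 * n))"
  shows "coeff j = (\<Sum>t\<in>T. alt t * class_sum j t)"
proof -
  let ?A = "\<lambda>t. {k. E k \<le> j \<and> [k = t] (mod 2 * n)}"
  have "{k. E k \<le> j \<and> n dvd j - E k} = (\<Union>t\<in>T. ?A t)" by (auto simp: classes)
  then have "coeff j = (\<Sum>k\<in>(\<Union>t\<in>T. ?A t). alt k * partition_count ((j - E k) div n))"
    by (simp add: coeff_def)
  also have "\<dots> = (\<Sum>t\<in>T. \<Sum>k\<in>?A t. alt k * partition_count ((j - E k) div n))"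
  proof (rule sum.UNION_disjoint[OF assms(1)])
    show "\<forall>t\<in>T. \<forall>t'\<in>T. t \<noteq> t' \<longrightarrow> ?A t \<inter> ?A t' = {}"
      using incong by (blast intro: cong_trans cong_sym)
  qed (use finite_E_le in auto)
  also have "\<dots> = (\<Sum>t\<in>T. alt t * class_sum j t)"
    unfolding class_sum_def sum_distrib_left
  proof (intro sum.cong refl)
    fix t k assume "k \<in> ?A t"
    then have "2 * n dvd k - t" by (simp add: cong_iff_dvd_diff)
    then have "2 dvd k - t" by (rule dvd_mult_left)
    then have "alt k = (alt t :: int)" by (simp add: alt_def)
    then show "alt k * partition_count ((j - E k) div n) = alt t * partition_count ((j - E k) div n)"
      by simp
  qed
  finally show ?thesis .
qed

lemma n_dvd_E_diff_iff:
  "n dvd E k - E k' \<longleftrightarrow> 2 * n dvd (k - k') * (a * (k + k') - c)"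
proof -
  have "even ((k - k') * (a * (k + k') - c))" using a_c by auto
  then obtain y where y: "(k - k') * (a * (k + k') - c) = 2 * y" by blast
  have "2 * (E k - E k') = B * ((k - k') * (a * (k + k') - c))"
    by (simp only: right_diff_distrib two_E) (simp add: algebra_simps)
  then have "E k - E k' = B * y" unfolding y by simp
  then have "n dvd E k - E k' \<longleftrightarrow> n dvd y"
    using coprime_Bn by (simp add: coprime_dvd_mult_right_iff coprime_commute)
  then show ?thesis by (simp add: y)
qed

lemma dvd_diff_E_iff: "n dvd j - E k' \<Longrightarrow> n dvd j - E k \<longleftrightarrow> n dvd E k - E k'"
  using dvd_diff[of n "j - E k'" "j - E k"] dvd_diff[of n "j - E k'" "E k - E k'"] by auto

lemma a_not_dvd_c: "\<not> a dvd c"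
  using a_c zdvd_imp_le[of a c] by auto

text \<open>
  This is where \<open>a\<close> not dividing \<open>c\<close> enters: it keeps \<open>R = B t\<close> off the multiples of \<open>p = m a B\<close>.
\<close>

lemma not_dvd_sum_quotient:
  assumes "a * x - c = q * t" "0 < q"
  shows "\<not> m * (a * B) dvd B * t"
proof
  assume "m * (a * B) dvd B * t"
  then have "B * (m * a) dvd B * t" by (simp add: ac_simps)
  then have "m * a dvd t" using B_pos by simp
  then have "a dvd q * t" by (meson dvd_mult dvd_mult_right)
  then have "a dvd a * x - c" by (simp add: assms)
  then show False using a_not_dvd_c dvd_diff[of a "a * x" "a * x - c"] by simp
qed


text \<open>
  In \<open>(l - k) (a (l + k) - c)\<close> the second factor is coprime to the odd part \<open>m\<close> of \<open>n\<close>, because a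
  common prime would divide \<open>a\<close> and hence \<open>c\<close>. Exactly one of the two factors is even, so the full
  power \<open>q\<close> of 2 divides one of them. The roots are therefore \<open>k\<close> and one class \<open>k'\<close> of opposite
  parity, with \<open>p = m a B\<close>, \<open>p' = q\<close>.
\<close>

lemma coeff_sign_if_odd_primes_divide:
  assumes primes: "\<And>r. prime r \<Longrightarrow> odd r \<Longrightarrow> r dvd n \<Longrightarrow> r dvd a"
  shows "\<exists>\<sigma>::int. \<sigma> \<noteq> 0 \<and> (\<forall>j. n dvd j - E k \<longrightarrow> 0 \<le> \<sigma> * coeff j)"
proof -
  have "n \<noteq> 0" "\<not> is_unit (2::int)" using n_pos by auto
  then obtain m s where m: "n = 2 ^ s * m" "odd m"
    by (metis multiplicity_decompose')
  define q where "q = (2::int) * 2 ^ s"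
  have q: "2 * n = q * m" "even q" "0 < q" using m(1) by (simp_all add: q_def)
  have m_pos: "0 < m" using m(1) n_pos by (simp add: zero_less_mult_iff)
  have "coprime (x :: int) q" if "odd x" for x
    using that by (simp add: q_def coprime_commute flip: power_Suc)
  note coprime_q = this
  have coprime_m: "coprime (a * x - c) m" for x
  proof (rule ccontr)
    assume "\<not> coprime (a * x - c) m"
    then have "\<not> is_unit (gcd (a * x - c) m)" by (simp add: coprime_iff_gcd_eq_1)
    then obtain r where r: "r dvd gcd (a * x - c) m" "prime r"
      using prime_divisor_exists[of "gcd (a * x - c) m"] m_pos by auto
    then have rm: "r dvd m" and rx: "r dvd a * x - c" by auto
    have "odd r" using rm m(2) dvd_trans by blast
    moreover have "r dvd n" using rm m(1) by (metis dvd_mult)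
    ultimately have "r dvd a" using primes r by blast
    then have "r dvd c" using rx dvd_diff[of r "a * x" "a * x - c"] by simp
    then show False using coprime_ac \<open>r dvd a\<close> r(2) coprime_common_divisor not_prime_unit by blast
  qed
  have "coprime (a * m) q" using coprime_q m(2) a_c by simp
  then obtain y where y: "[a * m * y = 1] (mod q)" using cong_solve_coprime_int by blast
  \<comment> \<open>This \<open>x\<close> solves \<open>a m x \<equiv> c - 2 a k (mod q)\<close>, so that \<open>q\<close> divides \<open>a (k + k') - c\<close> for \<open>k' = k + m x\<close>.\<close>
  define x where "x = y * (c - 2 * a * k)"
  have "q dvd a * m * y - 1" using y by (simp add: cong_iff_dvd_diff)
  then have "q dvd (a * m * y - 1) * (c - 2 * a * k)" by (rule dvd_mult2)
  then have x_dvd: "q dvd a * m * x + 2 * a * k - c" by (simp add: x_def algebra_simps)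
  define k' where "k' = k + m * x"
  have "a * (k + k') - c = a * m * x + 2 * a * k - c" by (simp add: k'_def algebra_simps)
  then obtain t where t: "a * (k + k') - c = q * t" using x_dvd by (metis dvdE)
  have "even (a * m * x + 2 * a * k - c)" using x_dvd q(2) dvd_trans by blast
  then have x: "odd x" using a_c m by auto
  have k': "odd (k' - k)" "m dvd k' - k" using x m by (simp_all add: k'_def)
  have classes: "n dvd E l - E k \<longleftrightarrow> [l = k] (mod 2 * n) \<or> [l = k'] (mod 2 * n)" for l
  proof
    assume "n dvd E l - E k"
    then have d: "q * m dvd (l - k) * (a * (l + k) - c)" by (simp add: n_dvd_E_diff_iff q)
    then have "m dvd (l - k) * (a * (l + k) - c)" by (rule dvd_mult_right)
    then have ml: "m dvd l - k"
      using coprime_m[of "l + k"] by (simp add: coprime_dvd_mult_left_iff coprime_commute)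
    have ql: "q dvd (l - k) * (a * (l + k) - c)" using d by (rule dvd_mult_left)
    have comb: "[l = z] (mod 2 * n)" if "q dvd l - z" "m dvd l - z" for z
      unfolding cong_iff_dvd_diff q(1) using that coprime_q[OF m(2)]
      by (intro divides_mult) (auto simp: coprime_commute)
    show "[l = k] (mod 2 * n) \<or> [l = k'] (mod 2 * n)"
    proof (cases "even (l - k)")
      case True
      then have "odd (a * (l + k) - c)" using a_c by auto
      from coprime_q[OF this] have "q dvd l - k"
        using ql by (simp only: coprime_dvd_mult_left_iff coprime_commute)
      then show ?thesis using comb ml by blast
    next
      case False
      then have "q dvd a * (l + k) - c"
        using ql coprime_q[OF False] by (simp only: coprime_dvd_mult_right_iff coprime_commute)
      moreover have "q dvd a * (k + k') - c" by (simp add: t)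
      ultimately have "q dvd (a * (l + k) - c) - (a * (k + k') - c)" by (rule dvd_diff)
      then have "q dvd a * (l - k')" by (simp add: algebra_simps)
      then have "q dvd l - k'"
        using coprime_q[of a] a_c by (simp add: coprime_dvd_mult_right_iff coprime_commute)
      moreover have "m dvd l - k'" using dvd_diff[OF ml k'(2)] by simp
      ultimately show ?thesis using comb by blast
    qed
  next
    assume "[l = k] (mod 2 * n) \<or> [l = k'] (mod 2 * n)"
    then show "n dvd E l - E k"
    proof
      assume "[l = k] (mod 2 * n)"
      then show ?thesis by (auto simp: n_dvd_E_diff_iff cong_iff_dvd_diff intro: dvd_mult2)
    next
      assume "[l = k'] (mod 2 * n)"
      then have l: "q * m dvd l - k'" by (simp add: cong_iff_dvd_diff q)
      have "m dvd (l - k') + (k' - k)" using dvd_mult_right[OF l] k'(2) by (rule dvd_add)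
      moreover have "q dvd a * (l - k') + (a * (k + k') - c)"
        using dvd_mult_left[OF l] by (intro dvd_add dvd_mult) (auto simp: t)
      ultimately have "m * q dvd (l - k) * (a * (l + k) - c)"
        by (intro mult_dvd_mono) (simp_all add: algebra_simps)
      then show ?thesis by (simp add: n_dvd_E_diff_iff q mult.commute[of q])
    qed
  qed
  have incong: "\<not> [k = k'] (mod 2 * n)"
  proof
    assume "[k = k'] (mod 2 * n)"
    then have "2 * n dvd k - k'" by (simp add: cong_iff_dvd_diff)
    then have "2 dvd k - k'" by (rule dvd_mult_left)
    then show False using k'(1) by simp
  qed
  have neq: "k \<noteq> k'" using k'(1) by auto
  have alt_k': "alt k' = - (alt k :: int)" using k'(1) by (auto simp: alt_def)
  have coeff: "coeff j = alt k * (class_sum j k - class_sum j k')" if "n dvd j - E k" for j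
  proof -
    have "coeff j = (\<Sum>t\<in>{k, k'}. alt t * class_sum j t)"
      using incong by (intro coeff_eq_class_sums)
        (auto simp: dvd_diff_E_iff[OF that] classes cong_sym_eq)
    then show ?thesis using neq by (simp add: alt_k' algebra_simps)
  qed
  define p where "p = m * (a * B)"
  define \<epsilon> where "\<epsilon> = (alt ((B * t) div p + x div q) :: int)"
  have pos: "0 \<le> \<epsilon> * (class_sum j k - class_sum j k')" if "n dvd j - E k" for j
    unfolding \<epsilon>_def
  proof (rule class_sum_diff_sign)
    show "B * (a * (k + k') - c) = q * (B * t)" by (simp add: t)
    show "a * B * (k' - k) = p * x" by (simp add: k'_def p_def)
    have "p * q = a * B * (q * m)" by (simp add: p_def)
    also have "\<dots> = 2 * a * n * B" by (simp flip: q(1))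
    finally show "p * q = 2 * a * n * B" .
    show "p \<noteq> q"
    proof
      assume "p = q"
      then have "a dvd q" by (metis p_def dvd_mult dvd_triv_left)
      then have "is_unit a" using coprime_q[of a] a_c by (metis coprime_common_divisor dvd_refl)
      then show False using a_not_dvd_c by (metis unit_imp_dvd)
    qed
    show "\<not> p dvd B * t" unfolding p_def using t q(3) by (rule not_dvd_sum_quotient)
    show "\<not> q dvd x" using x q(2) dvd_trans by blast
  qed (use that m_pos a_c B_pos q in \<open>simp_all add: p_def\<close>)
  have "(alt k * \<epsilon>) * coeff j = \<epsilon> * (class_sum j k - class_sum j k')" if "n dvd j - E k" for j
    by (simp only: coeff[OF that] alt_mult_cancel)
  moreover have "alt k * \<epsilon> \<noteq> 0" by (simp add: \<epsilon>_def alt_def)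
  ultimately show ?thesis using pos
    by (intro exI[of _ "alt k * \<epsilon>"] conjI allI impI) (simp_all only: add_nonneg_nonneg not_False_eq_True)
qed


text \<open>
  Modulo \<open>n\<close> the roots are \<open>k\<close> and the class \<open>k'\<close> with \<open>a (k + k') \<equiv> c\<close>. Solving the latter
  congruence modulo \<open>2 n\<close> forces \<open>k\<close> and \<open>k'\<close> to have opposite parity. If the two roots are distinct
  modulo \<open>n\<close>, the classes modulo \<open>2 n\<close> are paired as \<open>(k, k')\<close> and \<open>(k' + n, k + n)\<close>; passing from the
  first pair to the second replaces \<open>(R, S)\<close> by \<open>(R + p, - S)\<close>, which preserves the sign of
  \<open>class_sum_diff_sign\<close>.
\<close>

lemma coeff_sign_if_prime:
  assumes n: "prime n" "odd n" "\<not> n dvd a"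
  shows "\<exists>\<sigma>::int. \<sigma> \<noteq> 0 \<and> (\<forall>j. n dvd j - E k \<longrightarrow> 0 \<le> \<sigma> * coeff j)"
proof -
  have "coprime a n" using n by (metis coprime_commute prime_imp_coprime)
  then have "coprime a (2 * n)" using a_c by simp
  then obtain y where y: "[a * y = 1] (mod 2 * n)" using cong_solve_coprime_int by blast
  define k' where "k' = y * (c - a * k)"
  have "2 * n dvd a * y - 1" using y by (simp add: cong_iff_dvd_diff)
  then have "2 * n dvd (a * y - 1) * (c - a * k)" by (rule dvd_mult2)
  then have "2 * n dvd a * (k + k') - c" by (simp add: k'_def algebra_simps)
  then obtain t where t: "a * (k + k') - c = 2 * n * t" by blast
  have "even (a * (k + k') - c)" by (simp add: t)
  then have odd: "odd (k' - k)" using a_c by auto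
  have residues: "n dvd l - z \<longleftrightarrow> [l = z] (mod 2 * n) \<or> [l = z + n] (mod 2 * n)" for l z
  proof
    assume "n dvd l - z"
    then obtain x where x: "l - z = n * x" by blast
    show "[l = z] (mod 2 * n) \<or> [l = z + n] (mod 2 * n)"
    proof (cases "even x")
      case True
      then show ?thesis using x by (auto simp: cong_iff_dvd_diff)
    next
      case False
      then obtain w where "x = 2 * w + 1" by (blast elim: oddE)
      then have "l - (z + n) = 2 * n * w" using x by (simp add: algebra_simps)
      then show ?thesis by (simp add: cong_iff_dvd_diff)
    qed
  next
    assume "[l = z] (mod 2 * n) \<or> [l = z + n] (mod 2 * n)"
    then have "n dvd l - z \<or> n dvd l - (z + n)"
      by (auto simp: cong_iff_dvd_diff dest: dvd_mult_right)
    then show "n dvd l - z" by (metis diff_add_cancel diff_diff_eq dvd_add dvd_refl)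
  qed
  have dvd_iff: "n dvd E l - E k \<longleftrightarrow> n dvd l - k \<or> n dvd l - k'" for l
  proof -
    have "even ((l - k) * (a * (l + k) - c))" using a_c by auto
    then have "n dvd E l - E k \<longleftrightarrow> n dvd (l - k) * (a * (l + k) - c)"
      unfolding n_dvd_E_diff_iff using n(2)
      by (meson divides_mult coprime_left_2_iff_odd dvd_mult_right)
    also have "\<dots> \<longleftrightarrow> n dvd l - k \<or> n dvd a * (l + k) - c"
      using n(1) by (simp add: prime_dvd_mult_iff)
    also have "a * (l + k) - c = a * (l - k') + n * (2 * t)"
      using t by (simp add: algebra_simps)
    also have "n dvd \<dots> \<longleftrightarrow> n dvd a * (l - k')"
      by (rule dvd_add_left_iff) simp
    also have "\<dots> \<longleftrightarrow> n dvd l - k'"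
      using n by (simp add: prime_dvd_mult_iff)
    finally show ?thesis .
  qed
  have shift_n: "\<not> [z = z + n] (mod 2 * n)" for z
    using n_pos by (auto simp: cong_iff_dvd_diff dest: zdvd_imp_le)
  have alt_n: "alt (z + n) = - (alt z :: int)" for z using n(2) by (simp add: alt_def)
  have alt_k': "alt k' = - (alt k :: int)" using odd by (auto simp: alt_def)
  show ?thesis
  proof (cases "n dvd k' - k")
    case True
    have dvd_iff': "n dvd E l - E k \<longleftrightarrow> n dvd l - k" for l
      unfolding dvd_iff using True by (metis diff_add_cancel add_diff_eq dvd_add)
    have coeff: "coeff j = alt k * (class_sum j k - class_sum j (k + n))" if "n dvd j - E k" for j
    proof -
      have "n dvd j - E l \<longleftrightarrow> (\<exists>t\<in>{k, k + n}. [l = t] (mod 2 * n))" for l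
        unfolding dvd_diff_E_iff[OF that] unfolding dvd_iff' unfolding residues by simp
      then have "coeff j = (\<Sum>t\<in>{k, k + n}. alt t * class_sum j t)"
        using shift_n[of k] by (intro coeff_eq_class_sums) (auto simp: cong_sym_eq)
      then show ?thesis using n_pos by (simp add: alt_n algebra_simps)
    qed
    have "even (a * (k + (k + n)) - c)" using n(2) a_c by auto
    then obtain u where u: "a * (k + (k + n)) - c = 2 * u" by blast
    \<comment> \<open>The double root: here \<open>p' = 2\<close> and \<open>S = 1\<close>, so that \<open>S div p'\<close> is the term \<open>1 div 2\<close> below.\<close>
    define p where "p = n * (a * B)"
    define \<epsilon> where "\<epsilon> = (alt ((B * u) div p + 1 div 2) :: int)"
    have pos: "0 \<le> \<epsilon> * (class_sum j k - class_sum j (k + n))" if "n dvd j - E k" for j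
      unfolding \<epsilon>_def
    proof (rule class_sum_diff_sign)
      show "B * (a * (k + (k + n)) - c) = 2 * (B * u)" by (simp only: u)
      show "\<not> p dvd B * u" unfolding p_def using u by (rule not_dvd_sum_quotient) simp
      show "p \<noteq> 2"
      proof
        assume "p = 2"
        then have "a dvd 2" by (metis p_def dvd_mult dvd_triv_left)
        then have "a \<le> 2" by (simp add: zdvd_imp_le)
        then show False using a_c by presburger
      qed
    qed (use that n_pos a_c B_pos in \<open>simp_all add: p_def\<close>)
    have "(alt k * \<epsilon>) * coeff j = \<epsilon> * (class_sum j k - class_sum j (k + n))" if "n dvd j - E k" for j
      by (simp only: coeff[OF that] alt_mult_cancel distrib_left)
    moreover have "alt k * \<epsilon> \<noteq> 0" by (simp add: \<epsilon>_def alt_def)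
    ultimately show ?thesis using pos
    by (intro exI[of _ "alt k * \<epsilon>"] conjI allI impI) (simp_all only: add_nonneg_nonneg not_False_eq_True)
  next
    case False
    have incong: "\<not> [z = z'] (mod 2 * n)" if "\<not> n dvd z' - z" for z z'
      using that by (auto simp: cong_iff_dvd_diff dvd_diff_commute dest: dvd_mult_right)
    have *: "\<not> n dvd k' - k" "\<not> n dvd k' + n - k" "\<not> n dvd k' - (k + n)" "\<not> n dvd k' + n - (k + n)"
    proof -
      have "k' + n - k = k' - k + 1 * n" "k' - (k + n) = k' - k + (- 1) * n"
          "k' + n - (k + n) = k' - k" by simp_all
      then show "\<not> n dvd k' - k" "\<not> n dvd k' + n - k" "\<not> n dvd k' - (k + n)"
          "\<not> n dvd k' + n - (k + n)"
        using False by (simp_all only: dvd_add_times_triv_right_iff not_False_eq_True)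
    qed
    have coeff: "coeff j = alt k * ((class_sum j k - class_sum j k') +
        (class_sum j (k' + n) - class_sum j (k + n)))" if "n dvd j - E k" for j
    proof -
      have classes: "n dvd j - E l \<longleftrightarrow> (\<exists>t\<in>{k, k + n, k', k' + n}. [l = t] (mod 2 * n))" for l
        unfolding dvd_diff_E_iff[OF that] unfolding dvd_iff unfolding residues by auto
      have "coeff j = (\<Sum>t\<in>{k, k + n, k', k' + n}. alt t * class_sum j t)"
      proof (rule coeff_eq_class_sums)
        show "z = z'" if "z \<in> {k, k + n, k', k' + n}" "z' \<in> {k, k + n, k', k' + n}" "[z = z'] (mod 2 * n)" for z z'
          using that shift_n[of k] shift_n[of k'] *[THEN incong] by (auto simp: cong_sym_eq)
      qed (use classes in simp_all)
      moreover have "k \<noteq> k'" "k + n \<noteq> k'" "k \<noteq> k' + n" using * by auto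
      ultimately show ?thesis using n_pos by (simp add: alt_n alt_k' algebra_simps)
    qed
    define p where "p = 1 * (a * B)"
    define S where "S = k' - k"
    define \<epsilon> where "\<epsilon> = (alt ((B * t) div p + S div (2 * n)) :: int)"
    have p_pos: "0 < p" using a_c B_pos by (simp add: p_def)
    have pp: "p * (2 * n) = 2 * a * n * B" by (simp add: p_def)
    have p_neq: "p \<noteq> 2 * n"
    proof
      assume "p = 2 * n"
      then have "n dvd a * B" by (simp add: p_def)
      then have "n dvd B" using n by (simp add: prime_dvd_mult_iff)
      then show False using coprime_Bn n(1) by (metis coprime_common_divisor dvd_refl not_prime_unit)
    qed
    have p_ndvd: "\<not> p dvd B * t" unfolding p_def using t
      by (rule not_dvd_sum_quotient) (use n_pos in simp)
    have S_ndvd: "\<not> 2 * n dvd S" using odd dvd_mult_left unfolding S_def by blast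
    have 1: "B * (a * (k + k') - c) = 2 * n * (B * t)" by (simp add: t)
    have 2: "B * (a * (k' + n + (k + n)) - c) = 2 * n * (B * t + p)"
    proof -
      have "B * (a * (k' + n + (k + n)) - c) = B * (a * (k + k') - c) + 2 * n * p"
        by (simp add: p_def algebra_simps)
      then show ?thesis unfolding 1 by (simp add: algebra_simps)
    qed
    have \<epsilon>': "alt ((B * t + p) div p + (- S) div (2 * n)) = \<epsilon>"
    proof -
      have "(- S) div (2 * n) = - (S div (2 * n)) - 1"
        using S_ndvd n_pos by (simp add: zdiv_zminus1_eq_if dvd_eq_mod_eq_0)
      moreover have "(B * t + p) div p = B * t div p + 1" using p_pos by simp
      ultimately show ?thesis by (auto simp: \<epsilon>_def alt_def)
    qed
    have pos: "0 \<le> \<epsilon> * (class_sum j k - class_sum j k')"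
      "0 \<le> \<epsilon> * (class_sum j (k' + n) - class_sum j (k + n))" if "n dvd j - E k" for j
    proof -
      show "0 \<le> \<epsilon> * (class_sum j k - class_sum j k')"
        unfolding \<epsilon>_def
        by (rule class_sum_diff_sign[OF 1 _ pp p_neq p_pos _ p_ndvd S_ndvd that])
           (use n_pos in \<open>simp_all add: p_def S_def\<close>)
      have "n dvd E (k' + n) - E k" unfolding dvd_iff by simp
      then have "n dvd j - E (k' + n)" using that by (simp add: dvd_diff_E_iff)
      moreover have "\<not> p dvd B * t + p" "\<not> 2 * n dvd - S" using p_ndvd S_ndvd by simp_all
      ultimately show "0 \<le> \<epsilon> * (class_sum j (k' + n) - class_sum j (k + n))"
        unfolding \<epsilon>'[symmetric] using n_pos
        by (intro class_sum_diff_sign[OF 2 _ pp p_neq p_pos]) (simp_all add: p_def S_def algebra_simps)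
    qed
    have "(alt k * \<epsilon>) * coeff j = \<epsilon> * (class_sum j k - class_sum j k')
        + \<epsilon> * (class_sum j (k' + n) - class_sum j (k + n))" if "n dvd j - E k" for j
      by (simp only: coeff[OF that] alt_mult_cancel distrib_left)
    moreover have "alt k * \<epsilon> \<noteq> 0" by (simp add: \<epsilon>_def alt_def)
    ultimately show ?thesis using pos
    by (intro exI[of _ "alt k * \<epsilon>"] conjI allI impI) (simp_all only: add_nonneg_nonneg not_False_eq_True)
  qed
qed

end

lemma phi_nth:
  fixes a B c n :: nat
  assumes "theta_quotient (int a) (int B) (int c) (int n)"
  shows "fps_nth (phi a B c n) j = of_int (theta_quotient.coeff (int a) (int B) (int c) (int n) (int j))"
proof -
  interpret Q: theta_quotient "int a" "int B" "int c" "int n" by fact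
  define u where "u = B * (a - c) div 2"
  define v where "v = B * (a + c) div 2"
  have ac: "c < a" "odd a" "odd c" "0 < B" "0 < n" using Q.a_c Q.B_pos Q.n_pos by simp_all
  have "even (a - c)" "even (a + c)" using ac by simp_all
  then obtain d s where d: "a - c = 2 * d" and s: "a + c = 2 * s" by (blast elim: evenE)
  have u: "u = B * d" and v: "v = B * s" by (simp_all add: u_def v_def d s)
  have ds: "d + s = a" "0 < d" "0 < s" using d s ac by linarith+
  have int_d: "(int a - int c) div 2 = int d" using d ac by (simp flip: of_nat_diff)
  interpret T: theta_exponent Q.E u v "B * a"
  proof
    show "Q.E (k + 1) = Q.E k + int (B * a) * k + int u" for k
      by (simp add: Q.E_step u int_d)
    show "u + v = B * a" using ds by (simp add: u v flip: distrib_left)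
    show "0 < u" "0 < v" using ds ac by (simp_all add: u v)
  qed (simp_all add: Q.E_ge, simp add: Q.E_def)
  have "qpoch [fps_X ^ n] (fps_X ^ n) * partition_fps n = (1 :: rat fps)"
    using ac by (intro qpoch_mult_partition_fps)
  then have "T.theta = (T.theta * partition_fps n) * qpoch [fps_X ^ n] (fps_X ^ n :: rat fps)"
      and nz: "qpoch [fps_X ^ n] (fps_X ^ n :: rat fps) \<noteq> 0"
    by (auto simp: mult.assoc mult.commute[of "partition_fps n"])
  then have "T.theta / qpoch [fps_X ^ n] (fps_X ^ n :: rat fps) = T.theta * partition_fps n"
    by (metis nonzero_mult_div_cancel_right)
  then have "phi a B c n = T.theta * partition_fps n"
    unfolding phi_def using T.jacobi_triple_product[where 'a = rat] by (simp add: u_def v_def)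
  then have "fps_nth (phi a B c n) j =
      (\<Sum>k | Q.E k \<le> int j. alt k * fps_nth (partition_fps n) (j - nat (Q.E k)))"
    by (simp add: T.theta_mult_nth)
  also have "\<dots> = (\<Sum>k | Q.E k \<le> int j \<and> int n dvd int j - Q.E k.
      of_int (alt k * partition_count ((int j - Q.E k) div int n)))"
  proof (rule sum.mono_neutral_cong_right)
    show "finite {k. Q.E k \<le> int j}" using Q.finite_E_le[of "int j" "\<lambda>_. True"] by simp
    have int: "int (j - nat (Q.E k)) = int j - Q.E k" if "Q.E k \<le> int j" for k
      using that T.E_nonneg[of k] by simp
    have dvd: "n dvd j - nat (Q.E k) \<longleftrightarrow> int n dvd int j - Q.E k" if "Q.E k \<le> int j" for k
      by (simp flip: int[OF that])
    then show "\<forall>k\<in>{k. Q.E k \<le> int j} - {k. Q.E k \<le> int j \<and> int n dvd int j - Q.E k}.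
        alt k * fps_nth (partition_fps n) (j - nat (Q.E k)) = (0::rat)"
      by (simp add: partition_fps_def)
    fix k assume "k \<in> {k. Q.E k \<le> int j \<and> int n dvd int j - Q.E k}"
    then have k: "Q.E k \<le> int j" "n dvd j - nat (Q.E k)" using dvd by auto
    have "int ((j - nat (Q.E k)) div n) = (int j - Q.E k) div int n"
      by (simp only: zdiv_int int[OF k(1)])
    then show "alt k * fps_nth (partition_fps n) (j - nat (Q.E k)) =
        (of_int (alt k * partition_count ((int j - Q.E k) div int n)) :: rat)"
      using k(2) by (simp add: partition_fps_def alt_def)
  qed auto
  also have "\<dots> = of_int (Q.coeff (int j))" by (simp add: Q.coeff_def)
  finally show ?thesis .
qed

theorem theorem3p5:
  fixes a B c n :: nat
  assumes "0 < a" and "0 < B" and "0 < c" and "0 < n"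
    and "c < a"
    and "odd a" and "odd c"
    and "coprime a c"
    and "coprime B n"
    and "(\<forall>p. prime p \<and> odd p \<and> p dvd n \<longrightarrow> p dvd a) \<or> (prime n \<and> odd B)"
  shows "\<forall>j. fps_nth (phi a B c n) j * fps_nth (phi a B c n) (j + n) \<ge> 0"
proof
  fix j
  have Q: "theta_quotient (int a) (int B) (int c) (int n)"
    using assms by unfold_locales auto
  interpret Q: theta_quotient "int a" "int B" "int c" "int n" by (rule Q)
  have sign: "\<exists>\<sigma>::int. \<sigma> \<noteq> 0 \<and> (\<forall>j. int n dvd j - Q.E k \<longrightarrow> 0 \<le> \<sigma> * Q.coeff j)" for k
  proof (cases "\<forall>p. prime p \<and> odd p \<and> p dvd n \<longrightarrow> p dvd a")
    case True
    show ?thesis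
    proof (rule Q.coeff_sign_if_odd_primes_divide)
      fix r :: int assume r: "prime r" "odd r" "r dvd int n"
      define p where "p = nat r"
      have "r = int p" using prime_gt_0_int[OF r(1)] by (simp add: p_def)
      then show "r dvd int a" using True r by simp
    qed
  next
    case False
    then obtain p where p: "prime p" "odd p" "p dvd n" "\<not> p dvd a" by blast
    then have "p = n" using assms(10) False by (metis primes_dvd_imp_eq)
    then show ?thesis using p by (intro Q.coeff_sign_if_prime) auto
  qed
  have "0 \<le> Q.coeff (int j) * Q.coeff (int (j + n))"
  proof (cases "\<exists>k. int n dvd int j - Q.E k")
    case True
    then obtain k where k: "int n dvd int j - Q.E k" by blast
    have "int (j + n) - Q.E k = (int j - Q.E k) + int n" by simp
    then have k': "int n dvd int (j + n) - Q.E k" using k by (simp only: dvd_add dvd_refl)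
    obtain \<sigma> where \<sigma>: "\<sigma> \<noteq> 0" "0 \<le> \<sigma> * Q.coeff (int j)" "0 \<le> \<sigma> * Q.coeff (int (j + n))"
      using sign[of k] k k' by blast
    then show ?thesis by (auto simp: zero_le_mult_iff)
  next
    case False
    then show ?thesis by (simp add: Q.coeff_def)
  qed
  then have "0 \<le> (of_int (Q.coeff (int j) * Q.coeff (int (j + n))) :: rat)" by (simp only: of_int_0_le_iff)
  then show "0 \<le> fps_nth (phi a B c n) j * fps_nth (phi a B c n) (j + n)"
    by (simp only: phi_nth[OF Q] of_int_mult)
qed

end
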